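(* Let $G$ be a finite nilpotent group. Then $\Gamma_S(G)$ is bipartite if and only if $G$ is either a cyclic $p$-group (for some prime $p$), or a generalized quaternion group $Q_{2^n}$, or $Q_{2^a}\times C_{q^b}$ (where $a\ge 3$, $b\ge 1$ and $q$ is an odd prime), or a cyclic group $C_{p^kq^s}$, where $p,q$ are distinct primes and $k,s\ge 1$.
   Context: For a group $G$ with identity $e$, the intersection subgroup graph $\Gamma_S(G)$ is the simple graph whose vertices are the non-trivial subgroups $H$ of $G$ such that $H\cap K=\{e\}$ for some non-trivial subgroup $K$ of $G$; two distinct vertices $H,K$ are adjacent if and only if $H\cap K=\{e\}$. (The vertex set may be empty; the null graph is regarded as bipartite.) $C_n$ is the cyclic group of order $n$ and $Q_{2^a}$ ($a\ge 3$) is the generalized quaternion group of order $2^a$. *)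

theory Defs
  imports
    "HOL-Algebra.Algebra"
    "HOL-Computational_Algebra.Primes"
    "Graph_Theory.Pair_Digraph"
begin

definition commutator_subgroup :: "('a, 'b) monoid_scheme \<Rightarrow> 'a set \<Rightarrow> 'a set \<Rightarrow> 'a set" where
  "commutator_subgroup G H K =
     generate G (\<Union>h \<in> H. \<Union>k \<in> K. {h \<otimes>\<^bsub>G\<^esub> k \<otimes>\<^bsub>G\<^esub> inv\<^bsub>G\<^esub> h \<otimes>\<^bsub>G\<^esub> inv\<^bsub>G\<^esub> k})"

primrec lower_central_series :: "('a, 'b) monoid_scheme \<Rightarrow> nat \<Rightarrow> 'a set" where
  "lower_central_series G 0 = carrier G"
| "lower_central_series G (Suc n) =
     commutator_subgroup G (lower_central_series G n) (carrier G)"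

definition nilpotent_group :: "('a, 'b) monoid_scheme \<Rightarrow> bool" where
  "nilpotent_group G \<longleftrightarrow> group G \<and> (\<exists>n. lower_central_series G n = {\<one>\<^bsub>G\<^esub>})"

text \<open>
  The generalized quaternion group of order \<open>2 ^ n\<close>, for \<open>n \<ge> 3\<close>, has the presentation
  \<open>\<langle>x, y | x ^ (2 ^ (n - 1)) = 1, y ^ 2 = x ^ (2 ^ (n - 2)), y x y\<inverse> = x\<inverse>\<rangle>\<close>.
  Each element is uniquely \<open>x ^ i y ^ a\<close> with \<open>0 \<le> i < 2 ^ (n - 1)\<close> and
  \<open>a \<in> {0, 1}\<close>; it is encoded as the pair \<open>(i, a)\<close>, with \<open>a\<close> a truth value.
  For \<open>n < 3\<close> the definition is not meaningful.
\<close>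

definition generalized_quaternion :: "nat \<Rightarrow> (int \<times> bool) monoid" where
  "generalized_quaternion n =
     \<lparr>carrier = {0..<2 ^ (n - 1)} \<times> UNIV,
      monoid.mult = (\<lambda>(i, a) (j, b).
        ((i + (if a then - j else j) + (if a \<and> b then 2 ^ (n - 2) else 0)) mod 2 ^ (n - 1),
         a \<noteq> b)),
      one = (0, False)\<rparr>"

lemma group_generalized_quaternion:
  assumes "n \<ge> 3"
  shows "group (generalized_quaternion n)"
proof -
  define M :: int where "M = 2 ^ (n - 2)"
  have "n - Suc 0 = Suc (n - 2)"
    using assms by simp
  then have N: "(2 :: int) ^ (n - Suc 0) = 2 * M"
    by (simp add: M_def)
  have M: "M > 0" by (simp add: M_def)
  let ?Q = "generalized_quaternion n"
  show ?thesis
  proof (rule groupI)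
    show "x \<otimes>\<^bsub>?Q\<^esub> y \<in> carrier ?Q" if "x \<in> carrier ?Q" "y \<in> carrier ?Q" for x y
      using M by (auto simp: generalized_quaternion_def split: prod.splits)
    show "\<one>\<^bsub>?Q\<^esub> \<in> carrier ?Q"
      by (simp add: generalized_quaternion_def)
    show "x \<otimes>\<^bsub>?Q\<^esub> y \<otimes>\<^bsub>?Q\<^esub> z = x \<otimes>\<^bsub>?Q\<^esub> (y \<otimes>\<^bsub>?Q\<^esub> z)"
      if "x \<in> carrier ?Q" "y \<in> carrier ?Q" "z \<in> carrier ?Q" for x y z
    proof -
      obtain i a j b k c where [simp]: "x = (i, a)" "y = (j, b)" "z = (k, c)"
        by (metis prod.exhaust)
      have mod_eq: "w mod (M * 2) = w - M * 2 * (w div (M * 2))" for w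
        by (simp add: minus_mult_div_eq_mod)
      show ?thesis
        by (cases a; cases b; cases c)
           (simp_all add: generalized_quaternion_def N mod_eq_dvd_iff flip: M_def,
            simp_all add: mod_eq algebra_simps)
    qed
    show "\<one>\<^bsub>?Q\<^esub> \<otimes>\<^bsub>?Q\<^esub> x = x" if "x \<in> carrier ?Q" for x
      using that by (auto simp: generalized_quaternion_def)
    show "\<exists>y\<in>carrier ?Q. y \<otimes>\<^bsub>?Q\<^esub> x = \<one>\<^bsub>?Q\<^esub>" if "x \<in> carrier ?Q" for x
    proof -
      obtain i a where [simp]: "x = (i, a)" by (metis prod.exhaust)
      have "((i + M) mod (2 * M) - i + M) mod (2 * M) =
          ((i + M) mod (2 * M) + (M - i)) mod (2 * M)"
        by (simp add: algebra_simps)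
      also have "\<dots> = 0"
        by (simp add: mod_simps)
      finally have inv: "((i + M) mod (2 * M) - i + M) mod (2 * M) = 0" .
      show ?thesis
        by (rule bexI[of _ "((if a then i + M else - i) mod (2 * M), a)"])
           (use M in \<open>auto simp: generalized_quaternion_def N inv mod_simps simp flip: M_def\<close>)
    qed
  qed
qed

lemma order_generalized_quaternion:
  assumes "n \<ge> 3"
  shows "order (generalized_quaternion n) = 2 ^ n"
proof -
  obtain m where "n = Suc m" using assms by (cases n) auto
  then show ?thesis
    by (simp add: order_def generalized_quaternion_def card_cartesian_product nat_power_eq)
qed

lemma generalized_quaternion_relations:
  assumes "n \<ge> 3"
  defines "Q \<equiv> generalized_quaternion n" and "x \<equiv> (1 :: int, False)" and "y \<equiv> (0 :: int, True)"
  shows "x [^]\<^bsub>Q\<^esub> (2 ^ (n - 1) :: nat) = \<one>\<^bsub>Q\<^esub>"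
    and "y \<otimes>\<^bsub>Q\<^esub> y = x [^]\<^bsub>Q\<^esub> (2 ^ (n - 2) :: nat)"
    and "y \<otimes>\<^bsub>Q\<^esub> x \<otimes>\<^bsub>Q\<^esub> inv\<^bsub>Q\<^esub> y = inv\<^bsub>Q\<^esub> x"
    and "generate Q {x, y} = carrier Q"
proof -
  interpret group Q unfolding Q_def by (rule group_generalized_quaternion[OF assms(1)])
  have "(2 :: int) ^ 1 < 2 ^ (n - 1)"
    using assms(1) by (intro power_strict_increasing) auto
  then have N: "(2 :: int) ^ (n - Suc 0) > 2" by simp
  have x: "x \<in> carrier Q" and y: "y \<in> carrier Q"
    using N by (auto simp: Q_def x_def y_def generalized_quaternion_def)
  have pow: "x [^]\<^bsub>Q\<^esub> k = (int k mod 2 ^ (n - 1), False)" for k :: nat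
    by (induction k) (auto simp: Q_def x_def generalized_quaternion_def mod_simps add.commute)
  show "x [^]\<^bsub>Q\<^esub> (2 ^ (n - 1) :: nat) = \<one>\<^bsub>Q\<^esub>"
    by (simp add: pow) (simp add: Q_def generalized_quaternion_def)
  show "y \<otimes>\<^bsub>Q\<^esub> y = x [^]\<^bsub>Q\<^esub> (2 ^ (n - 2) :: nat)"
    by (simp add: pow) (simp add: Q_def y_def generalized_quaternion_def)
  have "x \<otimes>\<^bsub>Q\<^esub> (y \<otimes>\<^bsub>Q\<^esub> x) = y"
    using N by (simp add: Q_def x_def y_def generalized_quaternion_def mod_simps)
  then show "y \<otimes>\<^bsub>Q\<^esub> x \<otimes>\<^bsub>Q\<^esub> inv\<^bsub>Q\<^esub> y = inv\<^bsub>Q\<^esub> x"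
    using x y by (metis inv_solve_left inv_solve_right m_closed inv_closed)
  show "generate Q {x, y} = carrier Q"
  proof
    show "generate Q {x, y} \<subseteq> carrier Q"
      using x y by (intro generate_incl) auto
    show "carrier Q \<subseteq> generate Q {x, y}"
    proof
      fix z assume z: "z \<in> carrier Q"
      have sg: "subgroup (generate Q {x, y}) Q"
        using x y by (intro generate_is_subgroup) auto
      obtain i a where ia: "z = (i, a)" "0 \<le> i" "i < 2 ^ (n - 1)"
        using z by (auto simp: Q_def generalized_quaternion_def)
      have xi: "x [^]\<^bsub>Q\<^esub> (nat i) = (i, False)"
        using ia by (simp add: pow)
      have "x [^]\<^bsub>Q\<^esub> k \<in> generate Q {x, y}" for k :: nat
        by (induction k) (auto intro: generate.intros)
      then have "(i, False) \<in> generate Q {x, y}" by (metis xi)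
      moreover have "(i, False) \<otimes>\<^bsub>Q\<^esub> y = (i, True)"
        using ia by (simp add: Q_def y_def generalized_quaternion_def)
      moreover have "y \<in> generate Q {x, y}" by (auto intro: generate.incl)
      ultimately have "(i, True) \<in> generate Q {x, y}"
        by (metis generate.eng)
      with \<open>(i, False) \<in> generate Q {x, y}\<close> show "z \<in> generate Q {x, y}"
        using ia by (cases a) auto
    qed
  qed
qed

text \<open>
  Following the AFP entry Graph Theory, simple graphs are loop-free symmetric digraphs
  without parallel arcs.
\<close>

definition intersection_subgroup_graph :: "('a, 'b) monoid_scheme \<Rightarrow> 'a set pair_pre_digraph" where
  "intersection_subgroup_graph G =
     (let V = {H. subgroup H G \<and> H \<noteq> {\<one>\<^bsub>G\<^esub>} \<and>
                  (\<exists>K. subgroup K G \<and> K \<noteq> {\<one>\<^bsub>G\<^esub>} \<and> H \<inter> K = {\<one>\<^bsub>G\<^esub>})}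
      in \<lparr>pverts = V,
          parcs = {(H, K). H \<in> V \<and> K \<in> V \<and> H \<noteq> K \<and> H \<inter> K = {\<one>\<^bsub>G\<^esub>}}\<rparr>)"

lemma pair_graph_intersection_subgroup_graph:
  assumes "finite (carrier G)"
  shows "pair_graph (intersection_subgroup_graph G)"
proof -
  let ?\<Gamma> = "intersection_subgroup_graph G"
  have "pverts ?\<Gamma> \<subseteq> Pow (carrier G)"
    by (auto simp: intersection_subgroup_graph_def dest: subgroup.subset)
  then have fin: "finite (pverts ?\<Gamma>)"
    using assms by (meson finite_Pow_iff finite_subset)
  have sub: "parcs ?\<Gamma> \<subseteq> pverts ?\<Gamma> \<times> pverts ?\<Gamma>"
    by (auto simp: intersection_subgroup_graph_def Let_def)
  then have "finite (parcs ?\<Gamma>)"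
    using fin by (meson finite_SigmaI finite_subset)
  moreover have "sym (parcs ?\<Gamma>)"
    by (rule symI) (auto simp: intersection_subgroup_graph_def Let_def)
  moreover have "fst e \<noteq> snd e" if "e \<in> parcs ?\<Gamma>" for e
    using that by (auto simp: intersection_subgroup_graph_def Let_def)
  ultimately show ?thesis
    using fin sub by unfold_locales (auto simp: symmetric_def arcs_ends_def arc_to_ends_def)
qed

text \<open>The parts may be empty, so the null graph is bipartite.\<close>

definition bipartite :: "'a pair_pre_digraph \<Rightarrow> bool" where
  "bipartite \<Gamma> \<longleftrightarrow>
     (\<exists>U V. pverts \<Gamma> = U \<union> V \<and> U \<inter> V = {} \<and> parcs \<Gamma> \<subseteq> U \<times> V \<union> V \<times> U)"

end

theory Submission
  imports Defs "HOL-Number_Theory.Residues"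
begin

text \<open>
  Distinct subgroups of prime order intersect trivially, so three of them form a triangle in the
  graph. Hence a bipartite graph allows at most two, and they have different orders: in a
  \<open>p\<close>-group a central element of order \<open>p\<close> and any other element of order \<open>p\<close> would generate
  at least three. In a nilpotent group elements of coprime order commute, so \<open>G\<close> is the product
  of at most two Sylow subgroups, each with a unique subgroup of prime order. Such a \<open>p\<close>-group is
  cyclic or generalized quaternion: a maximal normal abelian subgroup \<open>A\<close> is cyclic and
  self-centralizing, and an element \<open>x\<close> outside \<open>A\<close> with \<open>x\<^sup>p\<close> in \<open>A\<close> can be multiplied by an
  element of \<open>A\<close> to get an element of order \<open>p\<close> outside \<open>A\<close>, unless \<open>p = 2\<close> and \<open>x\<close> inverts \<open>A\<close>.
  Conversely, in each of the listed groups every non-trivial subgroup contains one of at most two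
  fixed non-trivial elements.
\<close>

section \<open>Nilpotent groups\<close>

text \<open>The classification rests on extracting \<open>p\<close>-th roots of the identity outside
  \<open>A\<close>. If \<open>x a = a^r x\<close> and \<open>x^p = a^m\<close>, then
  \<open>(a^i x)^p = a^(i S + m)\<close> with \<open>S = 1 + r + ... + r^(p-1)\<close>. Since
  \<open>r = 1\<close> and \<open>m = 0\<close> modulo \<open>p\<close>, a suitable \<open>i\<close>
  exists as soon as \<open>S\<close> is \<open>p\<close> times a unit modulo the order of
  \<open>a\<close>; this fails only for \<open>p = 2\<close> and \<open>r = 3\<close> modulo 4. This
  controls only those \<open>x\<close> whose \<open>p\<close>-th power lies in \<open>A\<close>. The
  others are reached because 4 divides the order of \<open>a\<close>: if a power
  \<open>g^(2^j)\<close> with \<open>j > 0\<close> inverted \<open>a\<close>, then -1 would be a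
  square modulo 4. So every element outside \<open>A\<close> inverts \<open>a\<close>, the product
  of two of them centralizes \<open>a\<close>, and \<open>A\<close> has index 2. When two primes
  divide the order, uniqueness of the subgroup of order \<open>p\<close> comes from a subgroup of
  order \<open>q\<close> as the third vertex of the triangle, not from a central element.\<close>

context group
begin

text \<open>With \<open>m_assoc\<close> nesting products to the right, this rule and
  \<open>mult_inv_cancel\<close> cancel adjacent inverses inside a longer word.\<close>

lemma inv_mult_cancel: "x \<in> carrier G \<Longrightarrow> y \<in> carrier G \<Longrightarrow> inv x \<otimes> (x \<otimes> y) = y"
  by (simp flip: m_assoc)

lemma mult_inv_cancel: "x \<in> carrier G \<Longrightarrow> y \<in> carrier G \<Longrightarrow> x \<otimes> (inv x \<otimes> y) = y"
  by (simp flip: m_assoc)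

text \<open>A conjugate of a commutator is the commutator of the conjugates, so the generating set
  itself is closed under conjugation.\<close>

lemma normal_lower_central_series: "lower_central_series G n \<lhd> G"
proof (induction n)
  case 0
  show ?case by (simp add: normal_self)
next
  case (Suc n)
  let ?L = "lower_central_series G n"
  interpret L: normal ?L G by (rule Suc)
  let ?S = "\<Union>h \<in> ?L. \<Union>k \<in> carrier G. {h \<otimes> k \<otimes> inv h \<otimes> inv k}"
  have "generate G ?S \<lhd> G"
  proof (rule normal_generateI)
    show "?S \<subseteq> carrier G" using L.subset by auto
    fix h g assume "h \<in> ?S" and g: "g \<in> carrier G"
    then obtain a b where ab: "a \<in> ?L" "b \<in> carrier G" and h: "h = a \<otimes> b \<otimes> inv a \<otimes> inv b"
      by auto
    have a: "a \<in> carrier G" using ab L.subset by auto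
    have "g \<otimes> a \<otimes> inv g \<in> ?L" using ab g by (simp add: L.inv_op_closed2)
    moreover have "g \<otimes> b \<otimes> inv g \<in> carrier G" using ab g by simp
    moreover have "g \<otimes> h \<otimes> inv g =
        (g \<otimes> a \<otimes> inv g) \<otimes> (g \<otimes> b \<otimes> inv g) \<otimes> inv (g \<otimes> a \<otimes> inv g) \<otimes> inv (g \<otimes> b \<otimes> inv g)"
      using a ab(2) g by (simp add: h m_assoc inv_mult_group inv_mult_cancel mult_inv_cancel)
    ultimately show "g \<otimes> h \<otimes> inv g \<in> ?S" by blast
  qed
  then show ?case by (simp add: commutator_subgroup_def)
qed

lemma commutator_in_lower_central_series:
  assumes "x \<in> lower_central_series G n" "g \<in> carrier G"
  shows "x \<otimes> g \<otimes> inv x \<otimes> inv g \<in> lower_central_series G (Suc n)"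
  using assms by (auto simp: commutator_subgroup_def intro!: generate.incl)

lemma lower_central_series_subgroup:
  assumes "subgroup H G"
  shows "lower_central_series (G\<lparr>carrier := H\<rparr>) n \<subseteq> lower_central_series G n"
proof (induction n)
  case 0
  show ?case using assms by (simp add: subgroup.subset)
next
  case (Suc n)
  interpret H: subgroup H G by fact
  interpret HG: group "G\<lparr>carrier := H\<rparr>" by (rule H.subgroup_is_group[OF is_group])
  let ?L = "lower_central_series (G\<lparr>carrier := H\<rparr>) n"
  let ?S = "\<Union>h \<in> ?L. \<Union>k \<in> H. {h \<otimes> k \<otimes> inv\<^bsub>G\<lparr>carrier := H\<rparr>\<^esub> h \<otimes> inv\<^bsub>G\<lparr>carrier := H\<rparr>\<^esub> k}"
  have LH: "?L \<subseteq> H"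
    using normal.axioms(1)[OF HG.normal_lower_central_series, THEN subgroup.subset] by simp
  have inv_eq: "inv\<^bsub>G\<lparr>carrier := H\<rparr>\<^esub> h = inv h" if "h \<in> H" for h
    using m_inv_consistent[OF assms that] by simp
  have "?S = (\<Union>h \<in> ?L. \<Union>k \<in> H. {h \<otimes> k \<otimes> inv h \<otimes> inv k})"
    using LH by (intro SUP_cong refl) (simp add: inv_eq subset_iff)
  moreover have "\<dots> \<subseteq> H" using LH by auto
  ultimately have "generate (G\<lparr>carrier := H\<rparr>) ?S =
      generate G (\<Union>h \<in> ?L. \<Union>k \<in> H. {h \<otimes> k \<otimes> inv h \<otimes> inv k})"
    using generate_consistent[OF _ assms] by simp
  also have "\<dots> \<subseteq> generate G (\<Union>h \<in> lower_central_series G n. \<Union>k \<in> carrier G. {h \<otimes> k \<otimes> inv h \<otimes> inv k})"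
    using Suc H.subset by (intro mono_generate UN_mono) auto
  finally show ?case by (simp add: commutator_subgroup_def)
qed

lemma nilpotent_subgroup:
  assumes "nilpotent_group G" "subgroup H G"
  shows "nilpotent_group (G\<lparr>carrier := H\<rparr>)"
proof -
  interpret HG: group "G\<lparr>carrier := H\<rparr>" by (rule subgroup.subgroup_is_group[OF assms(2) is_group])
  obtain n where "lower_central_series G n = {\<one>}"
    using assms(1) by (auto simp: nilpotent_group_def)
  then have "lower_central_series (G\<lparr>carrier := H\<rparr>) n \<subseteq> {\<one>}"
    using lower_central_series_subgroup[OF assms(2), of n] by simp
  moreover have "\<one> \<in> lower_central_series (G\<lparr>carrier := H\<rparr>) n"
    using subgroup.one_closed[OF normal.axioms(1)[OF HG.normal_lower_central_series[of n]]] by simp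
  ultimately show ?thesis
    using HG.is_group by (auto simp: nilpotent_group_def)
qed

text \<open>With \<open>C\<close> the whole group and \<open>A\<close> trivial this yields a
  non-trivial central element; with \<open>C\<close> the centralizer of an abelian normal
  \<open>A\<close> it yields an element that can be adjoined to \<open>A\<close> without losing
  normality.\<close>

lemma nilpotent_central_mod:
  assumes "nilpotent_group G" "C \<lhd> G" "\<one> \<in> A" "\<not> C \<subseteq> A"
  obtains x where "x \<in> C" "x \<notin> A" "\<And>g. g \<in> carrier G \<Longrightarrow> x \<otimes> g \<otimes> inv x \<otimes> inv g \<in> A"
proof -
  interpret C: normal C G by fact
  \<comment> \<open>Take \<open>x\<close> in the last term of the lower central series that meets \<open>C - A\<close>.\<close>
  define P where "P = (\<lambda>n. C \<inter> lower_central_series G n \<subseteq> A)"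
  obtain m where "lower_central_series G m = {\<one>}"
    using assms(1) by (auto simp: nilpotent_group_def)
  then have "P m" using assms(3) by (auto simp: P_def)
  moreover have "\<not> P 0" using assms(4) C.subset by (auto simp: P_def)
  ultimately obtain n where n: "P (Suc n)" "\<not> P n"
    by (induction m) auto
  then obtain x where x: "x \<in> C" "x \<in> lower_central_series G n" "x \<notin> A" by (auto simp: P_def)
  have "x \<otimes> g \<otimes> inv x \<otimes> inv g \<in> A" if g: "g \<in> carrier G" for g
  proof -
    \<comment> \<open>The commutator is \<open>x\<close> times a conjugate of \<open>inv x\<close>,
      so it stays in the normal subgroup \<open>C\<close>.\<close>
    have "x \<otimes> (g \<otimes> inv x \<otimes> inv g) \<in> C"
      using x g C.inv_op_closed2[OF g] by blast
    then have "x \<otimes> g \<otimes> inv x \<otimes> inv g \<in> C"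
      using g x C.subset by (simp add: m_assoc subset_iff)
    then show ?thesis
      using n(1) commutator_in_lower_central_series[OF x(2) g] by (auto simp: P_def)
  qed
  with x show thesis using that by blast
qed

text \<open>Moving one \<open>x\<close> past \<open>y\<close> costs a factor \<open>c\<close>, and
  \<open>c\<close> commutes with \<open>x\<close>, so moving \<open>x [^] m\<close> costs
  \<open>c [^] m\<close>; but \<open>x [^] m\<close> is trivial.\<close>

lemma central_commutator_pow:
  assumes [simp]: "x \<in> carrier G" "y \<in> carrier G" "c \<in> carrier G"
    and xy: "x \<otimes> y = c \<otimes> (y \<otimes> x)" and cx: "c \<otimes> x = x \<otimes> c"
    and "x [^] (m::nat) = \<one>"
  shows "c [^] m = \<one>"
proof -
  have "x [^] k \<otimes> y = c [^] k \<otimes> (y \<otimes> x [^] k)" for k :: nat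
  proof (induction k)
    case (Suc k)
    have "x [^] Suc k \<otimes> y = x [^] k \<otimes> (c \<otimes> (y \<otimes> x))"
      by (simp add: m_assoc xy)
    also have "\<dots> = (x [^] k \<otimes> c) \<otimes> (y \<otimes> x)" by (simp add: m_assoc)
    also have "x [^] k \<otimes> c = c \<otimes> x [^] k"
      by (rule group_commutes_pow[symmetric, OF cx[symmetric], symmetric]) simp_all
    also have "(c \<otimes> x [^] k) \<otimes> (y \<otimes> x) = c \<otimes> (x [^] k \<otimes> y) \<otimes> x" by (simp add: m_assoc)
    also have "\<dots> = c \<otimes> c [^] k \<otimes> (y \<otimes> (x [^] k \<otimes> x))" by (simp add: Suc m_assoc)
    also have "c \<otimes> c [^] k = c [^] Suc k" by (metis assms(3) nat_pow_Suc2)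
    finally show ?case by simp
  qed simp
  from this[of m] show ?thesis using assms(6) by (simp add: r_cancel_one')
qed

text \<open>Exchanging \<open>x\<close> and \<open>y\<close> turns \<open>c\<close> into its
  inverse, so the order of \<open>c\<close> divides both \<open>m\<close> and
  \<open>n\<close>.\<close>

lemma central_commutator_trivial:
  assumes [simp]: "x \<in> carrier G" "y \<in> carrier G" "c \<in> carrier G"
    and xy: "x \<otimes> y = c \<otimes> (y \<otimes> x)" and cx: "c \<otimes> x = x \<otimes> c" and cy: "c \<otimes> y = y \<otimes> c"
    and "x [^] (m::nat) = \<one>" "y [^] (n::nat) = \<one>" "coprime m n"
  shows "c = \<one>"
proof -
  have "c [^] m = \<one>" by (rule central_commutator_pow[OF assms(1-3) xy cx]) fact
  moreover have "(inv c) [^] n = \<one>"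
  proof (rule central_commutator_pow[of y x])
    show "y \<otimes> x = inv c \<otimes> (x \<otimes> y)" by (simp add: xy inv_solve_left)
    show "inv c \<otimes> y = y \<otimes> inv c"
      by (metis assms(2,3) cy inv_closed inv_solve_left' inv_solve_right m_assoc m_closed)
  qed (use assms in auto)
  then have "c [^] n = \<one>" by (simp add: nat_pow_inv)
  ultimately have "ord c dvd m" "ord c dvd n" by (simp_all add: pow_eq_id)
  then have "ord c = 1" using \<open>coprime m n\<close> by (metis coprime_common_divisor_nat)
  then show ?thesis using ord_eq_1[of c] by simp
qed

lemma nilpotent_coprime_commute:
  assumes "nilpotent_group G" and x: "x \<in> carrier G" and y: "y \<in> carrier G"
    and xm: "x [^] (m::nat) = \<one>" and yn: "y [^] (n::nat) = \<one>" and "coprime m n"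
  shows "x \<otimes> y = y \<otimes> x"
proof -
  define c where "c = x \<otimes> y \<otimes> inv x \<otimes> inv y"
  have c: "c \<in> carrier G" using x y by (simp add: c_def)
  have xy: "x \<otimes> y = c \<otimes> (y \<otimes> x)" using x y by (simp add: c_def m_assoc inv_mult_cancel mult_inv_cancel)
  \<comment> \<open>If \<open>c\<close> lies in the \<open>i\<close>-th term, it is central modulo the next one.\<close>
  have "c \<in> lower_central_series G i" for i
  proof (induction i)
    case (Suc i)
    let ?N = "lower_central_series G (Suc i)"
    interpret N: normal ?N G by (rule normal_lower_central_series)
    let ?Q = "G Mod ?N"
    let ?f = "\<lambda>a. ?N #> a"
    interpret Q: group ?Q by (rule N.factorgroup_is_group)
    interpret f: group_hom G ?Q ?f
      by unfold_locales (rule N.r_coset_hom_Mod)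
    have central: "?f c \<otimes>\<^bsub>?Q\<^esub> ?f g = ?f g \<otimes>\<^bsub>?Q\<^esub> ?f c" if g: "g \<in> carrier G" for g
    proof -
      have "?f (c \<otimes> g \<otimes> inv c \<otimes> inv g) = \<one>\<^bsub>?Q\<^esub>"
        using N.rcos_const[OF is_group commutator_in_lower_central_series[OF Suc g]]
        by (simp add: FactGroup_def)
      then have "?f ((c \<otimes> g \<otimes> inv c \<otimes> inv g) \<otimes> (g \<otimes> c)) = ?f (g \<otimes> c)"
        using c g by (metis Q.l_one f.hom_closed f.hom_mult inv_closed m_closed)
      moreover have "(c \<otimes> g \<otimes> inv c \<otimes> inv g) \<otimes> (g \<otimes> c) = c \<otimes> g"
        using c g by (simp add: m_assoc inv_mult_cancel)
      ultimately show ?thesis using c g by (metis f.hom_mult)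
    qed
    \<comment> \<open>The images of \<open>x\<close> and \<open>y\<close> keep the coprime exponents
      \<open>m\<close> and \<open>n\<close>, so their commutator, central in the quotient, is
      trivial there: \<open>c\<close> descends one term further.\<close>
    have "?f c = \<one>\<^bsub>?Q\<^esub>"
    proof (rule Q.central_commutator_trivial)
      show "?f x \<otimes>\<^bsub>?Q\<^esub> ?f y = ?f c \<otimes>\<^bsub>?Q\<^esub> (?f y \<otimes>\<^bsub>?Q\<^esub> ?f x)"
        using x y c xy by (metis f.hom_mult m_closed)
      show "?f x [^]\<^bsub>?Q\<^esub> m = \<one>\<^bsub>?Q\<^esub>" using xm x by (metis f.hom_nat_pow f.hom_one)
      show "?f y [^]\<^bsub>?Q\<^esub> n = \<one>\<^bsub>?Q\<^esub>" using yn y by (metis f.hom_nat_pow f.hom_one)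
    qed (use x y c central assms f.hom_closed in auto)
    then have "?N #> c = ?N" by (simp add: FactGroup_def)
    then show ?case using rcos_self[OF c N.subgroup_axioms] by simp
  qed (use c in simp)
  moreover obtain k where "lower_central_series G k = {\<one>}"
    using assms(1) by (auto simp: nilpotent_group_def)
  ultimately have "c = \<one>" by blast
  then show ?thesis using xy x y by simp
qed

end

section \<open>Powers and conjugation\<close>

lemma prime_dvd_prime_power_imp_eq:
  fixes p r :: nat
  assumes "Factorial_Ring.prime r" "Factorial_Ring.prime p" "r dvd p ^ k"
  shows "r = p"
  using prime_dvd_power[OF assms(1,3)] assms(1,2) primes_dvd_imp_eq by blast

text \<open>By Fermat \<open>r ^ p = r\<close> modulo \<open>p\<close>.\<close>

lemma prime_dvd_minus_one_if_power:
  fixes r :: int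
  assumes "Factorial_Ring.prime p" "int p dvd r ^ p - 1"
  shows "int p dvd r - 1"
proof -
  have p: "Factorial_Ring.prime (int p)" using assms(1) by simp
  \<comment> \<open>\<open>fermat_theorem\<close> speaks about natural numbers, so \<open>r\<close>
    is replaced by its non-negative residue.\<close>
  define b where "b = nat (r mod int p)"
  have "int b = r mod int p" using assms(1) by (simp add: b_def prime_gt_0_nat)
  then have b: "[int b = r] (mod int p)" by (simp add: cong_def)
  have "\<not> int p dvd r"
  proof
    assume "int p dvd r"
    then have "int p dvd r ^ p" using assms(1) by (simp add: dvd_trans[OF _ dvd_power] prime_gt_0_nat)
    then have "int p dvd r ^ p - (r ^ p - 1)" using assms(2) by (rule dvd_diff)
    then show False using p by simp
  qed
  then have "\<not> int p dvd int b" using b cong_dvd_iff cong_sym by blast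
  then have "[b ^ (p - 1) = 1] (mod p)" using assms(1) by (intro fermat_theorem) simp_all
  then have "[int b ^ (p - 1) = 1] (mod int p)" by (metis cong_int_iff of_nat_1 of_nat_power)
  then have "[r ^ (p - 1) = 1] (mod int p)" using b by (metis cong_pow cong_sym cong_trans)
  then have "[r * r ^ (p - 1) = r * 1] (mod int p)" by (rule cong_scalar_left)
  also have "r * r ^ (p - 1) = r ^ p"
    using assms(1) by (metis power_eq_if prime_gt_0_nat less_irrefl)
  finally have "[r ^ p = r] (mod int p)" by simp
  moreover have "[r ^ p = 1] (mod int p)" using assms(2) by (simp add: cong_iff_dvd_diff)
  ultimately have "[r = 1] (mod int p)" by (metis cong_sym cong_trans)
  then show ?thesis by (simp add: cong_iff_dvd_diff)
qed

text \<open>This is the binomial expansion cut off after the linear term, all later terms being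
  multiples of \<open>d\<^sup>2\<close>.\<close>

lemma power_one_plus_cong:
  fixes d q :: int
  assumes "q dvd d"
  shows "[(1 + d) ^ j = 1 + int j * d] (mod q\<^sup>2)"
proof (induction j)
  case (Suc j)
  have "[(1 + d) * (1 + d) ^ j = (1 + d) * (1 + int j * d)] (mod q\<^sup>2)"
    using Suc by (rule cong_scalar_left)
  also have "(1 + d) * (1 + int j * d) = 1 + int (Suc j) * d + int j * d\<^sup>2"
    by (simp add: algebra_simps power2_eq_square)
  also have "[\<dots> = 1 + int (Suc j) * d] (mod q\<^sup>2)"
    using assms by (simp add: cong_iff_dvd_diff dvd_power_same)
  finally show ?case by simp
qed simp

text \<open>The sum is \<open>p\<close> modulo the square of \<open>p\<close>. With
  \<open>r = 1 + d\<close> it is congruent to \<open>p + d * p * (p - 1) / 2\<close>, and for odd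
  \<open>p\<close> both \<open>d\<close> and \<open>p * (p - 1) / 2\<close> are multiples of
  \<open>p\<close>. For \<open>p = 2\<close> the second factor is 1, so \<open>d\<close> itself has
  to be divisible by 4.\<close>

lemma geometric_sum_prime:
  fixes r :: int
  assumes p: "Factorial_Ring.prime p" and "int p dvd r - 1" and "p = 2 \<longrightarrow> 4 dvd r - 1"
  obtains u where "(\<Sum>j<p. r ^ j) = int p * u" "\<not> int p dvd u"
proof -
  have "[(\<Sum>j<p. r ^ j) = int p] (mod (int p)\<^sup>2)"
  proof (cases "p = 2")
    case True
    then have "(\<Sum>j<p. r ^ j) = 1 + r" by (simp add: numeral_2_eq_2)
    then show ?thesis using True assms(3) by (simp add: cong_iff_dvd_diff)
  next
    case False
    then have "odd p" using p primes_dvd_imp_eq two_is_prime_nat by blast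
    then obtain h where h: "p = 2 * h + 1" by (elim oddE)
    define d where "d = r - 1"
    have r: "r = 1 + d" and d: "int p dvd d" using assms(2) by (simp_all add: d_def)
    have "[(\<Sum>j<p. r ^ j) = (\<Sum>j<p. 1 + int j * d)] (mod (int p)\<^sup>2)"
      unfolding r by (intro cong_sum power_one_plus_cong d)
    also have "(\<Sum>j<p. 1 + int j * d) = int p + (\<Sum>j<p. int j) * d"
      by (simp add: sum.distrib sum_distrib_right)
    also have "(\<Sum>j<p. int j) = int p * int h"
      unfolding h by (induction h) (simp_all add: algebra_simps)
    also have "[int p + int p * int h * d = int p] (mod (int p)\<^sup>2)"
      using d by (auto simp: cong_iff_dvd_diff power2_eq_square)
    finally show ?thesis .
  qed
  then have "(int p)\<^sup>2 dvd (\<Sum>j<p. r ^ j) - int p" by (simp add: cong_iff_dvd_diff)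
  then obtain k where k: "(\<Sum>j<p. r ^ j) - int p = (int p)\<^sup>2 * k" by (elim dvdE)
  show thesis
  proof
    show "(\<Sum>j<p. r ^ j) = int p * (1 + int p * k)"
      using k by (simp add: algebra_simps power2_eq_square)
    show "\<not> int p dvd 1 + int p * k"
      using prime_gt_1_nat[OF p] by (simp add: dvd_add_left_iff)
  qed
qed

section \<open>Powers under conjugation, and centralizers\<close>

context group
begin

lemma conj_int_pow:
  assumes [simp]: "x \<in> carrier G" "a \<in> carrier G" and xa: "x \<otimes> a = a [^] (r::int) \<otimes> x"
  shows "x \<otimes> a [^] (k::int) = a [^] (r * k) \<otimes> x"
proof -
  have nat: "x \<otimes> a [^] int k = a [^] (r * int k) \<otimes> x" for k
  proof (induction k)
    case (Suc k)
    have "x \<otimes> a [^] int (Suc k) = x \<otimes> a [^] int k \<otimes> a"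
      by (simp add: m_assoc int_pow_int del: of_nat_Suc)
    also have "\<dots> = a [^] (r * int k) \<otimes> (x \<otimes> a)" by (simp add: Suc m_assoc)
    also have "\<dots> = a [^] (r * int k) \<otimes> a [^] r \<otimes> x" by (simp add: xa m_assoc)
    also have "a [^] (r * int k) \<otimes> a [^] r = a [^] (r * int (Suc k))"
      by (simp add: algebra_simps flip: int_pow_mult)
    finally show ?case .
  qed simp
  show ?thesis
  proof (cases k rule: int_cases2)
    case (nonpos j)
    \<comment> \<open>For a negative exponent both sides are multiplied by
      \<open>a [^] (r * int j)\<close>, where the case already proved applies, and this factor is
      cancelled.\<close>
    have "a [^] (r * int j) \<otimes> (x \<otimes> a [^] k) = x \<otimes> (a [^] int j \<otimes> a [^] k)"
      by (simp add: nat flip: m_assoc)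
    also have "\<dots> = x" using nonpos by (simp flip: int_pow_mult)
    also have "\<dots> = a [^] (r * int j) \<otimes> (a [^] (r * k) \<otimes> x)"
      using nonpos by (simp flip: m_assoc int_pow_mult)
    finally show ?thesis by simp
  qed (use nat in auto)
qed

lemma conj_pow_int_pow:
  assumes [simp]: "x \<in> carrier G" "a \<in> carrier G" and xa: "x \<otimes> a = a [^] (r::int) \<otimes> x"
  shows "x [^] n \<otimes> a = a [^] (r ^ n) \<otimes> x [^] (n::nat)"
proof (induction n)
  case (Suc n)
  have "x [^] Suc n \<otimes> a = x \<otimes> (x [^] n \<otimes> a)"
    by (metis assms(1,2) m_assoc nat_pow_Suc2 nat_pow_closed)
  also have "\<dots> = a [^] (r * r ^ n) \<otimes> (x \<otimes> x [^] n)"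
    using conj_int_pow[OF assms, of "r ^ n"] by (simp add: Suc flip: m_assoc)
  also have "x \<otimes> x [^] n = x [^] Suc n" by (metis assms(1) nat_pow_Suc2)
  finally show ?case by simp
qed simp

text \<open>When all copies of \<open>x\<close> are collected on the right, a factor
  \<open>a [^] i\<close> that passes \<open>j\<close> of them becomes
  \<open>a [^] (i * r ^ j)\<close>. The formula serves to choose \<open>i\<close> so that the power
  becomes trivial.\<close>

lemma mult_pow_conj:
  assumes [simp]: "x \<in> carrier G" "a \<in> carrier G" and xa: "x \<otimes> a = a [^] (r::int) \<otimes> x"
  shows "(a [^] i \<otimes> x) [^] n = a [^] (i * (\<Sum>j<n. r ^ j)) \<otimes> x [^] (n::nat)"
proof (induction n)
  case (Suc n)
  let ?S = "\<Sum>j<n. r ^ j"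
  \<comment> \<open>The new factor is put on the left, so the sum is unfolded at its first term: the
    old sum gets multiplied by \<open>r\<close>.\<close>
  have S: "(\<Sum>j<Suc n. r ^ j) = 1 + r * ?S"
    by (subst sum.lessThan_Suc_shift) (simp add: sum_distrib_left)
  have "(a [^] i \<otimes> x) [^] Suc n = (a [^] i \<otimes> x) \<otimes> (a [^] i \<otimes> x) [^] n"
    by (metis assms(1,2) int_pow_closed m_closed nat_pow_Suc2)
  also have "\<dots> = a [^] i \<otimes> (x \<otimes> a [^] (i * ?S)) \<otimes> x [^] n" by (simp add: Suc m_assoc)
  also have "\<dots> = (a [^] i \<otimes> a [^] (r * (i * ?S))) \<otimes> (x \<otimes> x [^] n)"
    by (simp add: conj_int_pow[OF assms] m_assoc)
  also have "x \<otimes> x [^] n = x [^] Suc n" by (metis assms(1) nat_pow_Suc2)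
  also have "a [^] i \<otimes> a [^] (r * (i * ?S)) = a [^] (i * (\<Sum>j<Suc n. r ^ j))"
    by (simp only: S) (simp add: algebra_simps flip: int_pow_mult)
  finally show ?case .
qed simp

lemma subgroup_centralizer:
  assumes "S \<subseteq> carrier G"
  shows "subgroup {g \<in> carrier G. \<forall>s\<in>S. g \<otimes> s = s \<otimes> g} G"
proof (rule subgroupI)
  fix g h assume gh: "g \<in> {g \<in> carrier G. \<forall>s\<in>S. g \<otimes> s = s \<otimes> g}"
  { fix s assume s: "s \<in> S"
    then have sc: "s \<in> carrier G" using assms by auto
    have "g \<otimes> s = s \<otimes> g" using gh s by auto
    then have "inv g \<otimes> s = s \<otimes> inv g"
      using gh sc by (metis (no_types, lifting) inv_closed inv_solve_left' inv_solve_right m_assoc m_closed mem_Collect_eq) }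
  then show "inv g \<in> {g \<in> carrier G. \<forall>s\<in>S. g \<otimes> s = s \<otimes> g}" using gh by auto
  assume "h \<in> {g \<in> carrier G. \<forall>s\<in>S. g \<otimes> s = s \<otimes> g}"
  then show "g \<otimes> h \<in> {g \<in> carrier G. \<forall>s\<in>S. g \<otimes> s = s \<otimes> g}"
    using gh assms by (auto simp: m_assoc subset_iff) (metis m_assoc)
qed (use assms in \<open>auto intro!: exI[of _ \<one>]\<close>)

text \<open>The centralizer argument is applied twice: first to \<open>S\<close>, so that everything
  generated commutes with \<open>S\<close>, then to the generated subgroup.\<close>

lemma generate_commute:
  assumes S: "S \<subseteq> carrier G" and comm: "\<And>s t. s \<in> S \<Longrightarrow> t \<in> S \<Longrightarrow> s \<otimes> t = t \<otimes> s"
    and "x \<in> generate G S" "y \<in> generate G S"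
  shows "x \<otimes> y = y \<otimes> x"
proof -
  have *: "generate G S \<subseteq> {g \<in> carrier G. \<forall>s\<in>T. g \<otimes> s = s \<otimes> g}"
    if "T \<subseteq> carrier G" "\<And>s t. s \<in> S \<Longrightarrow> t \<in> T \<Longrightarrow> s \<otimes> t = t \<otimes> s" for T
    using that S by (intro generate_subgroup_incl subgroup_centralizer) auto
  have "generate G S \<subseteq> carrier G" using S by (rule generate_incl)
  moreover have "\<And>s t. s \<in> S \<Longrightarrow> t \<in> generate G S \<Longrightarrow> s \<otimes> t = t \<otimes> s"
    using *[OF S comm] by auto
  ultimately show ?thesis using *[of "generate G S"] assms(3,4) by blast
qed

lemma normal_centralizer:
  assumes "A \<lhd> G"
  shows "{g \<in> carrier G. \<forall>a\<in>A. g \<otimes> a = a \<otimes> g} \<lhd> G" (is "?C \<lhd> G")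
proof (rule normal_invI)
  interpret A: normal A G by fact
  show "subgroup ?C G" by (rule subgroup_centralizer[OF A.subset])
  fix g h assume g: "g \<in> carrier G" and h: "h \<in> ?C"
  have "g \<otimes> h \<otimes> inv g \<otimes> a = a \<otimes> (g \<otimes> h \<otimes> inv g)" if a: "a \<in> A" for a
  proof -
    have ac: "a \<in> carrier G" using a A.subset by auto
    \<comment> \<open>\<open>h\<close> commutes with this conjugate; conjugating that relation back
      by \<open>g\<close> gives the claim for \<open>a\<close>.\<close>
    have "inv g \<otimes> a \<otimes> g \<in> A" using A.inv_op_closed1[OF g a] .
    then have "h \<otimes> (inv g \<otimes> a \<otimes> g) = (inv g \<otimes> a \<otimes> g) \<otimes> h" using h by auto
    then have "g \<otimes> (h \<otimes> (inv g \<otimes> a \<otimes> g)) \<otimes> inv g = g \<otimes> ((inv g \<otimes> a \<otimes> g) \<otimes> h) \<otimes> inv g" by simp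
    then show ?thesis using g h ac by (simp add: m_assoc mult_inv_cancel)
  qed
  then show "g \<otimes> h \<otimes> inv g \<in> ?C" using g h by auto
qed

end

section \<open>Finite p-groups with a unique subgroup of order p\<close>

context group
begin

lemma coprime_int_pow_generates:
  assumes "a \<in> carrier G" "a [^] (n::nat) = \<one>" "coprime m (int n)"
  obtains u where "(a [^] (m::int)) [^] (u::int) = a"
proof -
  obtain u v where "u * m + v * int n = 1"
    using assms(3) bezout_int[of m "int n"] by auto
  then have "a = a [^] (m * u + int n * v)" using assms(1) by (simp add: algebra_simps)
  also have "\<dots> = (a [^] m) [^] u \<otimes> (a [^] int n) [^] v"
    using assms(1) by (simp add: int_pow_pow flip: int_pow_mult)
  also have "a [^] int n = \<one>" using assms(2) by (simp add: int_pow_int)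
  finally show thesis using that[of u] assms(1) by simp
qed

text \<open>Cauchy's theorem, as the case of exponent 1 of Sylow's theorem; the cofactor
  \<open>m\<close> may still be divisible by \<open>p\<close>.\<close>

lemma exists_subgroup_card_prime:
  assumes "finite (carrier G)" "Factorial_Ring.prime p" "subgroup A G" "p dvd card A"
  obtains H where "subgroup H G" "H \<subseteq> A" "card H = p"
proof -
  interpret A: group "G\<lparr>carrier := A\<rparr>" by (rule subgroup.subgroup_is_group[OF assms(3) is_group])
  obtain m where "card A = p ^ 1 * m" using assms(4) by (auto elim: dvdE)
  then obtain H where H: "subgroup H (G\<lparr>carrier := A\<rparr>)" "card H = p"
    using sylow_thm[OF assms(2) A.is_group, of 1 m] assms(1) subgroup.subset[OF assms(3)]
    by (auto simp: order_def intro: finite_subset)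
  then show thesis
    using that incl_subgroup[OF assms(3) H(1)] subgroup.subset[OF H(1)] by simp
qed

end

text \<open>The condition \<open>unique\<close> is an at-most-one statement; existence comes from
  Cauchy's theorem, and the trivial group (\<open>n = 0\<close>) is included.\<close>

locale p_group_unique_subgroup = group G for G (structure) +
  fixes p n :: nat
  assumes prime_p: "Factorial_Ring.prime p"
    and order_eq: "order G = p ^ n"
    and nilpotent: "nilpotent_group G"
    and unique: "\<And>H K. subgroup H G \<Longrightarrow> subgroup K G \<Longrightarrow> card H = p \<Longrightarrow> card K = p \<Longrightarrow> H = K"
begin

lemma finite_carrier: "finite (carrier G)"
  using order_eq prime_p by (metis order_def card.infinite power_not_zero not_prime_0)

lemma pow_order: "x \<in> carrier G \<Longrightarrow> x [^] (p ^ n) = \<one>"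
  using pow_order_eq_1 order_eq by metis

lemma prime_dvd_card:
  assumes "subgroup A G" "A \<noteq> {\<one>}"
  shows "p dvd card A"
proof -
  have "card A dvd p ^ n" using lagrange[OF assms(1)] order_eq by (metis dvd_triv_right)
  then obtain k where k: "card A = p ^ k" using prime_p divides_primepow_nat by blast
  have "k \<noteq> 0"
  proof
    assume "k = 0"
    then obtain z where "A = {z}" using k by (auto simp: card_1_singleton_iff)
    then show False using assms subgroup.one_closed by blast
  qed
  then show ?thesis using k by simp
qed

text \<open>The unique subgroup of order \<open>p\<close> lies in every non-trivial subgroup. The
  later contradictions come from building a solution of \<open>x [^] p = \<one>\<close> outside some
  \<open>A\<close>.\<close>

lemma mem_if_pow_eq_one:
  assumes A: "subgroup A G" "A \<noteq> {\<one>}" and x: "x \<in> carrier G" "x [^] p = \<one>"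
  shows "x \<in> A"
proof (cases "x = \<one>")
  case True
  then show ?thesis using A by (simp add: subgroup.one_closed)
next
  case False
  have "ord x dvd p" using x by (simp add: pow_eq_id)
  then have "ord x = p" using False x(1) prime_p ord_eq_1[of x] by (auto simp: prime_nat_iff)
  then have "card (generate G {x}) = p"
    using generate_pow_card[OF x(1)] by simp
  moreover have "subgroup (generate G {x}) G" using x by (intro generate_is_subgroup) simp
  moreover obtain H where "subgroup H G" "H \<subseteq> A" "card H = p"
    using exists_subgroup_card_prime[OF finite_carrier prime_p A(1) prime_dvd_card[OF A]] .
  ultimately have "generate G {x} \<subseteq> A" using unique by metis
  then show ?thesis by (auto intro: generate.incl)
qed

text \<open>This replaces an element outside \<open>A\<close> by a power of it that is still outside
  but has its \<open>p\<close>-th power in \<open>A\<close>.\<close>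

lemma last_power_outside:
  assumes "\<one> \<in> A" "x \<in> carrier G" "x \<notin> A"
  obtains j where "x [^] (p ^ j) \<notin> A" "x [^] (p ^ Suc j) \<in> A"
proof -
  have "\<exists>j. x [^] (p ^ j) \<notin> A \<and> x [^] (p ^ Suc j) \<in> A" if "x [^] (p ^ m) \<in> A" for m
    using that assms(2,3) by (induction m) auto
  then show thesis using that pow_order[OF assms(2)] assms(1) by metis
qed

text \<open>Let \<open>a\<close> have maximal order, and let \<open>b\<close> lie outside its powers
  with \<open>b [^] p = a [^] m\<close>. If \<open>p\<close> divides \<open>m\<close>, then
  \<open>b\<close> times a power of \<open>a\<close> has trivial \<open>p\<close>-th power and still
  lies outside. Otherwise \<open>b [^] p\<close> generates the powers of \<open>a\<close>, so
  \<open>b\<close> generates a strictly larger cyclic group.\<close>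

lemma cyclic_if_commutative:
  assumes A: "subgroup A G" and comm: "\<And>x y. x \<in> A \<Longrightarrow> y \<in> A \<Longrightarrow> x \<otimes> y = y \<otimes> x"
  obtains a where "a \<in> A" "A = range (\<lambda>i::int. a [^] i)"
proof -
  interpret A: subgroup A G by fact
  have fin: "finite (ord ` A)" using finite_carrier A.subset by (auto intro: finite_subset)
  have "Max (ord ` A) \<in> ord ` A" using fin subgroupE(2)[OF A] by (intro Max_in) auto
  then obtain a where a: "a \<in> A" and "Max (ord ` A) = ord a" by auto
  then have max: "ord b \<le> ord a" if "b \<in> A" for b using that fin Max_ge[OF fin, of "ord b"] by auto
  have ac: "a \<in> carrier G" using a by simp
  define B where "B = range (\<lambda>i::int. a [^] i)"
  have B: "subgroup B G" unfolding B_def by (rule subgroup_of_powers[OF ac])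
  have BA: "B \<subseteq> A" using a A subgroup_int_pow_closed by (auto simp: B_def)
  have aB: "a \<in> B" unfolding B_def using ac by (metis int_pow_1 rangeI)
  have "A \<subseteq> B"
  proof (rule ccontr)
    assume "\<not> A \<subseteq> B"
    then obtain b0 where b0: "b0 \<in> A" "b0 \<notin> B" by auto
    then obtain j where j: "b0 [^] (p ^ j) \<notin> B" "b0 [^] (p ^ Suc j) \<in> B"
      using last_power_outside[OF subgroup.one_closed[OF B]] A.subset by blast
    define b where "b = b0 [^] (p ^ j)"
    have "b0 [^] int (p ^ j) \<in> A" using b0(1) A subgroup_int_pow_closed by blast
    then have "b \<in> A" by (simp only: b_def int_pow_int)
    moreover have "b [^] p = b0 [^] (p ^ Suc j)"
      using b0(1) by (simp add: b_def nat_pow_pow mult.commute)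
    ultimately have b: "b \<in> A" "b \<notin> B" "b [^] p \<in> B" using j by (simp_all add: b_def)
    have bc: "b \<in> carrier G" using b by simp
    obtain m :: int where m: "b [^] p = a [^] m" using b by (auto simp: B_def)
    show False
    proof (cases "int p dvd m")
      case True
      then obtain j where j: "m = int p * j" by (elim dvdE)
      have "(b \<otimes> a [^] (- j)) [^] p = b [^] p \<otimes> (a [^] (- j)) [^] p"
        using b(1) a A ac bc by (intro pow_mult_distrib comm) (auto intro: subgroup_int_pow_closed)
      also have "\<dots> = a [^] m \<otimes> a [^] (- j * int p)"
        unfolding m using int_pow_pow[OF ac, of "- j" "int p"] by (simp only: int_pow_int)
      also have "\<dots> = \<one>" using ac j by (simp flip: int_pow_mult)
      finally have pow_one: "(b \<otimes> a [^] (- j)) [^] p = \<one>" .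
      \<comment> \<open>Maximality again: if \<open>a\<close> were trivial, every element of
        \<open>A\<close> would have order 1, including \<open>b\<close>.\<close>
      have "B \<noteq> {\<one>}"
      proof
        assume "B = {\<one>}"
        then have "ord a = 1" using aB by simp
        then have "ord b \<le> 1" using max[OF b(1)] by simp
        then have "ord b = 1" using ord_ge_1[OF finite_carrier bc] by simp
        then show False using ord_eq_1[OF bc] b(2) subgroup.one_closed[OF B] by simp
      qed
      then have "b \<otimes> a [^] (- j) \<in> B"
        using mem_if_pow_eq_one[OF B _ _ pow_one] ac bc by simp
      moreover have "a [^] j \<in> B" by (simp add: B_def)
      ultimately have "b \<otimes> a [^] (- j) \<otimes> a [^] j \<in> B" using B by (simp add: subgroup.m_closed)
      moreover have "b \<otimes> a [^] (- j) \<otimes> a [^] j = b" using ac bc by (simp add: m_assoc flip: int_pow_mult)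
      ultimately show False using b(2) by simp
    next
      case False
      have "coprime m (int (p ^ n))"
        using prime_imp_coprime[OF _ False] prime_p by (simp add: coprime_commute)
      then obtain u where "(a [^] m) [^] (u::int) = a"
        using coprime_int_pow_generates[OF ac pow_order[OF ac]] by metis
      then have ab: "a = b [^] (int p * u)" using m int_pow_pow[OF bc, of "int p" u] by (simp add: int_pow_int)
      have "a \<in> generate G {b}" using ab by (auto simp: generate_pow[OF bc])
      then have "generate G {a} \<subseteq> generate G {b}"
        using generate_subgroup_incl[OF _ generate_is_subgroup] bc by simp
      moreover have "card (generate G {b}) \<le> card (generate G {a})"
        using max[OF b(1)] generate_pow_card ac bc by metis
      moreover have "finite (generate G {b})"
        using generate_incl[of "{b}"] bc finite_carrier by (auto intro: finite_subset)
      ultimately have "generate G {a} = generate G {b}" by (metis card_seteq)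
      then have "b \<in> generate G {a}" by (auto intro: generate.incl)
      then show False using b(2) ac by (auto simp: generate_pow B_def)
    qed
  qed
  then have "A = B" using BA by auto
  then show thesis using that[OF a] by (simp add: B_def)
qed

lemma self_centralizing_cyclic_normal_subgroup:
  obtains a where "a \<in> carrier G" "range (\<lambda>i::int. a [^] i) \<lhd> G"
    "\<And>g. g \<in> carrier G \<Longrightarrow> g \<otimes> a = a \<otimes> g \<Longrightarrow> g \<in> range (\<lambda>i::int. a [^] i)"
proof -
  define \<A> where "\<A> = {A. A \<lhd> G \<and> (\<forall>x\<in>A. \<forall>y\<in>A. x \<otimes> y = y \<otimes> x)}"
  have "\<A> \<subseteq> Pow (carrier G)" unfolding \<A>_def using normal_imp_subgroup subgroup.subset by blast
  then have "finite \<A>" using finite_carrier by (simp add: finite_subset)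
  moreover have "{\<one>} \<in> \<A>" by (auto simp: \<A>_def one_is_normal)
  ultimately obtain A where A: "A \<in> \<A>" and max: "\<And>B. B \<in> \<A> \<Longrightarrow> A \<subseteq> B \<Longrightarrow> A = B"
    using finite_has_maximal[of \<A>] by blast
  interpret A: normal A G using A by (simp add: \<A>_def)
  have comm: "x \<otimes> y = y \<otimes> x" if "x \<in> A" "y \<in> A" for x y using A that by (simp add: \<A>_def)
  obtain a where a: "a \<in> A" and A_eq: "A = range (\<lambda>i::int. a [^] i)"
    using cyclic_if_commutative[OF A.subgroup_axioms comm] by blast
  define C where "C = {g \<in> carrier G. \<forall>a\<in>A. g \<otimes> a = a \<otimes> g}"
  have C: "C \<lhd> G" unfolding C_def by (rule normal_centralizer[OF A.normal_axioms])
  have "C \<subseteq> A"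
  proof (rule ccontr)
    assume "\<not> C \<subseteq> A"
    then obtain x where xC: "x \<in> C" and xA: "x \<notin> A"
      and x: "\<And>g. g \<in> carrier G \<Longrightarrow> x \<otimes> g \<otimes> inv x \<otimes> inv g \<in> A"
      using nilpotent_central_mod[OF nilpotent C A.one_closed] by blast
    have xc: "x \<in> carrier G" and comm_x: "\<And>b. b \<in> A \<Longrightarrow> x \<otimes> b = b \<otimes> x" using xC by (auto simp: C_def)
    \<comment> \<open>These two cosets need not form a subgroup, but they are closed under
      conjugation and their elements commute pairwise; both properties carry over to the subgroup
      they generate.\<close>
    define S where "S = A \<union> (\<lambda>b. b \<otimes> x) ` A"
    have Sc: "S \<subseteq> carrier G" using xc by (auto simp: S_def)
    have "generate G S \<lhd> G"
    proof (rule normal_generateI[OF Sc])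
      fix h g assume h: "h \<in> S" and g: "g \<in> carrier G"
      show "g \<otimes> h \<otimes> inv g \<in> S"
      proof (cases "h \<in> A")
        case True
        then show ?thesis using A.inv_op_closed2[OF g] by (simp add: S_def)
      next
        case False
        then obtain b where b: "b \<in> A" "h = b \<otimes> x" using h by (auto simp: S_def)
        \<comment> \<open>The conjugate \<open>g \<otimes> x \<otimes> inv g\<close> equals this
          element times \<open>x\<close>, so conjugation maps the coset of \<open>x\<close> to
          itself.\<close>
        have "inv (x \<otimes> g \<otimes> inv x \<otimes> inv g) \<in> A" using x[OF g] by simp
        then have "(g \<otimes> b \<otimes> inv g) \<otimes> inv (x \<otimes> g \<otimes> inv x \<otimes> inv g) \<in> A"
          using A.inv_op_closed2[OF g b(1)] by simp
        moreover have "g \<otimes> h \<otimes> inv g = (g \<otimes> b \<otimes> inv g) \<otimes> inv (x \<otimes> g \<otimes> inv x \<otimes> inv g) \<otimes> x"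
          using g b xc by (simp add: m_assoc inv_mult_group inv_mult_cancel)
        ultimately show ?thesis by (simp add: S_def)
      qed
    qed
    moreover have "s \<otimes> t = t \<otimes> s" if "s \<in> S" "t \<in> S" for s t
    proof -
      have 1: "b \<otimes> (c \<otimes> x) = c \<otimes> x \<otimes> b" if b: "b \<in> A" and c: "c \<in> A" for b c
      proof -
        have "b \<otimes> (c \<otimes> x) = b \<otimes> c \<otimes> x" using b c xc by (simp add: m_assoc)
        also have "\<dots> = c \<otimes> (b \<otimes> x)" using b c xc by (subst comm[OF b c]) (simp add: m_assoc)
        also have "\<dots> = c \<otimes> x \<otimes> b" using b c xc by (subst comm_x[OF b, symmetric]) (simp add: m_assoc)
        finally show ?thesis .
      qed
      have 2: "b \<otimes> x \<otimes> (c \<otimes> x) = c \<otimes> x \<otimes> (b \<otimes> x)" if b: "b \<in> A" and c: "c \<in> A" for b c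
      proof -
        have "b \<otimes> x \<otimes> (c \<otimes> x) = b \<otimes> (x \<otimes> c) \<otimes> x" using b c xc by (simp add: m_assoc)
        also have "\<dots> = c \<otimes> x \<otimes> b \<otimes> x" by (simp only: comm_x[OF c] 1[OF b c])
        also have "\<dots> = c \<otimes> x \<otimes> (b \<otimes> x)" using b c xc by (simp add: m_assoc)
        finally show ?thesis .
      qed
      show ?thesis using that comm 1 2 by (auto simp: S_def)
    qed
    ultimately have "generate G S \<in> \<A>"
      using generate_commute[OF Sc] by (simp add: \<A>_def)
    moreover have "A \<subseteq> generate G S" by (auto simp: S_def intro: generate.incl)
    ultimately have "A = generate G S" by (rule max)
    moreover have "x \<in> S" unfolding S_def using xc A.one_closed by (metis UnI2 imageI l_one)
    ultimately show False using xA by (auto intro: generate.incl)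
  qed
  moreover have "g \<in> C" if "g \<in> carrier G" "g \<otimes> a = a \<otimes> g" for g
  proof -
    have "g \<otimes> a = a [^] (1::int) \<otimes> g" using that a by simp
    from conj_int_pow[OF that(1) _ this] show ?thesis using that a by (auto simp: C_def A_eq)
  qed
  ultimately show thesis using that[of a] a A_eq A.normal_axioms by auto
qed

end

section \<open>Recognizing cyclic and generalized quaternion groups\<close>

context group
begin

lemma cyclic_iso_integer_mod_group:
  assumes fin: "finite (carrier G)" and "cyclic_group G"
  shows "G \<cong> integer_mod_group (order G)"
proof -
  obtain a where a: "a \<in> carrier G" and G: "carrier G = range (\<lambda>i::int. a [^] i)"
    using assms by (auto simp: cyclic_group)
  define N where "N = ord a"
  have N: "N > 0" using ord_ge_1[OF fin a] by (simp add: N_def)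
  have "carrier G = generate G {a}" unfolding G using a by (auto simp: generate_pow)
  then have order: "order G = N" using generate_pow_card[OF a] by (simp add: order_def N_def)
  have pow_mod: "a [^] (i mod int N) = a [^] i" for i
    unfolding int_pow_eq[OF a] N_def by (simp add: mod_eq_dvd_iff flip: mod_eq_dvd_iff)
  let ?Z = "integer_mod_group N"
  have "(\<lambda>i. a [^] i) \<in> iso ?Z G"
  proof (rule isoI)
    show "(\<lambda>i. a [^] i) \<in> hom ?Z G"
      using a by (auto intro!: homI simp: pow_mod int_pow_mult)
    show "bij_betw (\<lambda>i. a [^] i) (carrier ?Z) (carrier G)"
    proof (intro bij_betwI')
      fix i j assume "i \<in> carrier ?Z" "j \<in> carrier ?Z"
      then have "0 \<le> i" "i < int N" "0 \<le> j" "j < int N" using N by (auto simp: carrier_integer_mod_group)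
      moreover have "a [^] i = a [^] j \<longleftrightarrow> j mod int N = i mod int N"
        unfolding int_pow_eq[OF a] N_def by (simp add: mod_eq_dvd_iff)
      ultimately show "a [^] i = a [^] j \<longleftrightarrow> i = j" by auto
    next
      fix y assume "y \<in> carrier G"
      then obtain i :: int where "y = a [^] i" by (auto simp: G)
      then show "\<exists>i\<in>carrier ?Z. y = a [^] i"
        using N by (intro bexI[of _ "i mod int N"]) (auto simp: pow_mod carrier_integer_mod_group)
    qed (use a in simp)
  qed
  then have "?Z \<cong> G" by (auto simp: is_iso_def)
  then show ?thesis unfolding order by (rule group.iso_sym[OF group_integer_mod_group])
qed

text \<open>The isomorphism sends the pair \<open>(i, b)\<close> to \<open>a [^] i\<close>, times
  \<open>y\<close> if \<open>b\<close> holds. The premise \<open>cover\<close> expresses that the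
  powers of \<open>a\<close> have index at most 2.\<close>

lemma iso_generalized_quaternion:
  assumes a: "a \<in> carrier G" and y: "y \<in> carrier G"
    and n: "n \<ge> 3" and ord: "ord a = 2 ^ (n - 1)"
    and ya: "y \<otimes> a = a [^] (-1::int) \<otimes> y" and yy: "y \<otimes> y = a [^] (2 ^ (n - 2) :: int)"
    and y_notin: "y \<notin> range (\<lambda>i::int. a [^] i)"
    and cover: "\<And>g. g \<in> carrier G \<Longrightarrow> g \<notin> range (\<lambda>i::int. a [^] i) \<Longrightarrow> g \<otimes> y \<in> range (\<lambda>i::int. a [^] i)"
  shows "G \<cong> generalized_quaternion n"
proof -
  let ?Q = "generalized_quaternion n"
  let ?N = "2 ^ (n - Suc 0) :: int"
  define f where "f = (\<lambda>(i::int, b). a [^] i \<otimes> (if b then y else \<one>))"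
  have eq: "a [^] i = a [^] j \<longleftrightarrow> j mod ?N = i mod ?N" for i j :: int
    unfolding int_pow_eq[OF a] using ord by (simp add: mod_eq_dvd_iff)
  have pow_mod: "a [^] (i mod ?N) = a [^] i" for i by (simp add: eq)
  have y_pow: "y \<otimes> a [^] i = a [^] (- i) \<otimes> y" for i :: int
    using conj_int_pow[OF y a ya, of i] by simp
  have "f \<in> iso ?Q G"
  proof (rule isoI)
    show "f \<in> hom ?Q G"
    proof (rule homI)
      fix u v assume "u \<in> carrier ?Q" "v \<in> carrier ?Q"
      obtain i b j c where [simp]: "u = (i, b)" "v = (j, c)" by fastforce
      show "f (u \<otimes>\<^bsub>?Q\<^esub> v) = f u \<otimes> f v"
      proof (cases b)
        case False
        then show ?thesis using a y
          by (simp add: f_def generalized_quaternion_def pow_mod int_pow_mult m_assoc)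
      next
        case True
        have "a [^] i \<otimes> y \<otimes> (a [^] j \<otimes> z) = a [^] (i - j) \<otimes> (y \<otimes> z)" if z: "z \<in> carrier G" for z
        proof -
          have "a [^] i \<otimes> y \<otimes> (a [^] j \<otimes> z) = a [^] i \<otimes> (y \<otimes> a [^] j) \<otimes> z"
            using a y z by (simp add: m_assoc)
          also have "\<dots> = a [^] i \<otimes> a [^] (- j) \<otimes> (y \<otimes> z)"
            using a y z by (simp add: y_pow m_assoc)
          also have "a [^] i \<otimes> a [^] (- j) = a [^] (i - j)" using a by (simp flip: int_pow_mult)
          finally show ?thesis .
        qed
        from this[of "if c then y else \<one>"] show ?thesis using True a y
          by (simp add: f_def generalized_quaternion_def pow_mod int_pow_mult yy)
      qed
    qed (use a y in \<open>auto simp: f_def split: prod.splits\<close>)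
    have cases_f: "\<exists>u\<in>carrier ?Q. f u = g" if g: "g \<in> carrier G" for g
    proof (cases "g \<in> range (\<lambda>i::int. a [^] i)")
      case True
      then obtain i :: int where "g = a [^] i" by auto
      then show ?thesis using a
        by (intro bexI[of _ "(i mod ?N, False)"]) (auto simp: f_def pow_mod generalized_quaternion_def)
    next
      case False
      then obtain i :: int where i: "g \<otimes> y = a [^] i" using cover[OF g] by auto
      \<comment> \<open>Here \<open>g\<close> is \<open>a [^] i \<otimes> inv y\<close>. Since
        \<open>y \<otimes> y\<close> is a power of \<open>a\<close> and \<open>y\<close> inverts
        \<open>a\<close>, the inverse of \<open>y\<close> is
        \<open>a [^] (2 ^ (n - 2)) \<otimes> y\<close>; this gives the shift in the
        preimage.\<close>
      have "g \<otimes> y \<otimes> y = a [^] i \<otimes> y" using i by simp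
      then have "g \<otimes> a [^] (2 ^ (n - 2) :: int) = a [^] i \<otimes> y" using g y by (simp add: m_assoc yy)
      then have "g = a [^] i \<otimes> y \<otimes> inv (a [^] (2 ^ (n - 2) :: int))" using g y a by (simp add: inv_solve_right)
      also have "\<dots> = a [^] i \<otimes> (y \<otimes> a [^] (- (2 ^ (n - 2)) :: int))" using a y by (simp add: int_pow_neg m_assoc)
      also have "\<dots> = a [^] (i + 2 ^ (n - 2)) \<otimes> y" unfolding y_pow using a y by (simp add: int_pow_mult m_assoc)
      finally show ?thesis using a
        by (intro bexI[of _ "((i + 2 ^ (n - 2)) mod ?N, True)"]) (auto simp: f_def pow_mod generalized_quaternion_def)
    qed
    show "bij_betw f (carrier ?Q) (carrier G)"
    proof (intro bij_betwI')
      fix u v assume uv: "u \<in> carrier ?Q" "v \<in> carrier ?Q"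
      obtain i b j c where [simp]: "u = (i, b)" "v = (j, c)" by fastforce
      have ij: "0 \<le> i" "i < ?N" "0 \<le> j" "j < ?N" using uv by (auto simp: generalized_quaternion_def)
      show "f u = f v \<longleftrightarrow> u = v"
      proof
        assume fuv: "f u = f v"
        have False if "a [^] k \<otimes> y = a [^] l" for k l :: int
        proof -
          have "y = inv (a [^] k) \<otimes> a [^] l" using that a y by (metis int_pow_closed inv_mult_cancel)
          also have "\<dots> = a [^] (l - k)" using a by (simp add: int_pow_diff int_pow_mult flip: int_pow_neg) (simp flip: int_pow_mult)
          finally show False using y_notin by auto
        qed
        then have "b = c" using fuv a by (cases b; cases c) (auto simp: f_def, metis)
        then have "a [^] i = a [^] j" using fuv a y by (auto simp: f_def split: if_splits)
        then show "u = v" using ij \<open>b = c\<close> by (simp add: eq)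
      qed simp
    next
      fix g assume "g \<in> carrier G" then show "\<exists>u\<in>carrier ?Q. g = f u" using cases_f by metis
    qed (use a y in \<open>auto simp: f_def split: prod.splits\<close>)
  qed
  then have "?Q \<cong> G" by (auto simp: is_iso_def)
  then show ?thesis by (rule group.iso_sym[OF group_generalized_quaternion[OF n]])
qed

end

section \<open>Classification of the p-groups with a unique subgroup of order p\<close>

context p_group_unique_subgroup
begin

text \<open>No \<open>a [^] i \<otimes> x\<close> lies in \<open>A\<close>, so none has a trivial
  \<open>p\<close>-th power. Each conclusion comes from the congruence that this excludes for a
  suitable \<open>i\<close>, or from \<open>x\<close> not commuting with \<open>a\<close>.\<close>

lemma outside_self_centralizing:
  assumes a: "a \<in> carrier G" and A: "range (\<lambda>i::int. a [^] i) \<lhd> G"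
    and self_centralizing: "\<And>g. g \<in> carrier G \<Longrightarrow> g \<otimes> a = a \<otimes> g \<Longrightarrow> g \<in> range (\<lambda>i::int. a [^] i)"
    and x: "x \<in> carrier G" "x \<notin> range (\<lambda>i::int. a [^] i)" "x [^] p \<in> range (\<lambda>i::int. a [^] i)"
  shows "p = 2" "4 dvd ord a" "x \<otimes> a = a [^] (-1::int) \<otimes> x" "x \<otimes> x = a [^] (int (ord a) div 2)"
proof -
  let ?A = "range (\<lambda>i::int. a [^] i)"
  interpret A: normal ?A G by fact
  let ?N = "int (ord a)"
  have one: "a [^] i = \<one> \<longleftrightarrow> ?N dvd i" for i :: int using int_pow_eq_id[OF a] .
  have eq: "a [^] i = a [^] j \<longleftrightarrow> ?N dvd j - i" for i j :: int using int_pow_eq[OF a] .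
  have aA: "a \<in> ?A" using a by (metis int_pow_1 rangeI)
  have "ord a dvd p ^ n" using pow_order[OF a] by (simp add: pow_eq_id a)
  then obtain k where k: "ord a = p ^ k" using prime_p divides_primepow_nat by blast
  have x_not_comm: "x \<otimes> a \<noteq> a \<otimes> x" using self_centralizing[OF x(1)] x(2) by auto
  have a_nontrivial: "a \<noteq> \<one>" using x_not_comm x(1) by auto
  have A_nontrivial: "?A \<noteq> {\<one>}"
  proof
    assume "?A = {\<one>}"
    with aA have "a \<in> {\<one>}" by (simp only:)
    then show False using a_nontrivial by simp
  qed
  have "k > 0" using a_nontrivial k ord_eq_1[OF a] by (cases k) auto
  then have pN: "int p dvd ?N" by (simp add: k)
  have "x \<otimes> a \<otimes> inv x \<in> ?A" using A.inv_op_closed2[OF x(1) aA] .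
  then obtain r :: int where "x \<otimes> a \<otimes> inv x = a [^] r" by auto
  then have xa: "x \<otimes> a = a [^] r \<otimes> x" using x(1) a by (metis inv_solve_right int_pow_closed m_closed)
  have r: "\<not> ?N dvd r - 1"
  proof
    assume "?N dvd r - 1"
    then have "a [^] r = a" using eq[of 1 r] a by simp
    then show False using xa x_not_comm by simp
  qed
  obtain m :: int where m: "x [^] p = a [^] m" using x(3) by auto
  \<comment> \<open>Being a power of \<open>a\<close>, \<open>x [^] p\<close> acts trivially on
    \<open>a\<close>, while it also acts with exponent \<open>r ^ p\<close>.\<close>
  have "x [^] p \<otimes> a = a \<otimes> x [^] p"
    using int_pow_mult[OF a, of m 1] int_pow_mult[OF a, of 1 m] a by (simp add: m add.commute)
  then have "a [^] (r ^ p) \<otimes> x [^] p = a \<otimes> x [^] p"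
    using conj_pow_int_pow[OF x(1) a xa, of p] by simp
  then have "a [^] (r ^ p) = a" using x(1) a by simp
  then have rp: "?N dvd r ^ p - 1" using eq[of 1 "r ^ p"] a by simp
  then have pr: "int p dvd r - 1"
    using pN prime_dvd_minus_one_if_power[OF prime_p] dvd_trans by blast
  \<comment> \<open>Otherwise \<open>x [^] p\<close> generates the powers of \<open>a\<close>, so
    \<open>a\<close> is a power of \<open>x\<close> and commutes with it.\<close>
  have pm: "int p dvd m"
  proof (rule ccontr)
    assume "\<not> int p dvd m"
    then have "coprime m (int (p ^ n))"
      using prime_imp_coprime[of "int p" m] prime_p by (simp add: coprime_commute)
    then obtain u where u: "(a [^] m) [^] (u::int) = a"
      using coprime_int_pow_generates[OF a pow_order[OF a]] by metis
    have "x [^] (int p * u) = a" using u m int_pow_pow[OF x(1), of "int p" u] by (simp add: int_pow_int)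
    then have "x \<otimes> a = a \<otimes> x"
      using int_pow_mult[OF x(1), of 1 "int p * u"] int_pow_mult[OF x(1), of "int p * u" 1] x(1)
      by (simp add: add.commute)
    then show False using x_not_comm by simp
  qed
  have no_root: "\<not> ?N dvd i * (\<Sum>j<p. r ^ j) + m" for i
  proof
    assume "?N dvd i * (\<Sum>j<p. r ^ j) + m"
    then have "(a [^] i \<otimes> x) [^] p = \<one>"
      using mult_pow_conj[OF x(1) a xa, of i p] a by (simp add: m one flip: int_pow_mult)
    then have "a [^] i \<otimes> x \<in> ?A"
      using mem_if_pow_eq_one[OF A.subgroup_axioms A_nontrivial] a x(1) by simp
    moreover have "inv (a [^] i) \<in> ?A" by (rule A.m_inv_closed) simp
    ultimately have "inv (a [^] i) \<otimes> (a [^] i \<otimes> x) \<in> ?A" by (rule A.m_closed[rotated])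
    moreover have "inv (a [^] i) \<otimes> (a [^] i \<otimes> x) = x" using a x(1) by (simp add: inv_mult_cancel)
    ultimately show False using x(2) by (simp only:)
  qed
  \<comment> \<open>With \<open>w\<close> an inverse of \<open>u\<close> modulo the order of
    \<open>a\<close>, the exponent \<open>i = - j * w\<close> solves the congruence that
    \<open>no_root\<close> forbids.\<close>
  have not4: "p = 2 \<and> \<not> 4 dvd r - 1"
  proof (rule ccontr)
    assume "\<not> (p = 2 \<and> \<not> 4 dvd r - 1)"
    then obtain u where u: "(\<Sum>j<p. r ^ j) = int p * u" "\<not> int p dvd u"
      using geometric_sum_prime[OF prime_p pr] by blast
    obtain j where j: "m = int p * j" using pm by (elim dvdE)
    have "coprime u ?N" using u(2) prime_imp_coprime[of "int p" u] prime_p by (simp add: k coprime_commute)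
    then obtain w v where "w * u + v * ?N = 1" using bezout_int[of u ?N] by auto
    then have "1 - w * u = ?N * v" by (simp add: algebra_simps)
    moreover have "(- j * w) * (\<Sum>j<p. r ^ j) + m = int p * j * (1 - w * u)"
      by (simp add: u j algebra_simps)
    ultimately show False using no_root[of "- j * w"] by simp
  qed
  then show p2: "p = 2" by simp
  \<comment> \<open>The order of \<open>a\<close> is a power of 2, so the odd \<open>e\<close> is a
    unit modulo it and can be cancelled twice below.\<close>
  obtain e where e: "r - 1 = 2 * e" "odd e"
  proof -
    have "2 dvd r - 1" using pr by (simp only: p2 of_nat_numeral)
    then obtain e where "r - 1 = 2 * e" by (elim dvdE)
    moreover from this have "odd e" using not4 by auto
    ultimately show thesis using that by blast
  qed
  have xx: "x [^] p = x \<otimes> x" using x(1) by (simp add: p2 numeral_2_eq_2)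
  obtain h where h: "?N = 2 * h" using pN p2 by auto
  have cop: "coprime e ?N" using e(2) by (simp add: k p2)
  \<comment> \<open>\<open>x\<close> commutes with its own square \<open>a [^] m\<close>, so the
    order of \<open>a\<close> divides \<open>(r - 1) * m\<close>; thus \<open>m\<close> is a
    multiple of half the order.\<close>
  have "a [^] (r * m) \<otimes> x = a [^] m \<otimes> x"
    using conj_int_pow[OF x(1) a xa, of m] x(1) by (simp add: xx m_assoc flip: m)
  then have "a [^] m = a [^] (r * m)" using a x(1) by simp
  then have "?N dvd e * (2 * m)" using e by (simp add: eq algebra_simps)
  then have "?N dvd 2 * m" using cop by (simp add: coprime_dvd_mult_right_iff coprime_commute)
  then obtain c where c: "m = h * c" using h by auto
  have S: "(\<Sum>j<p. r ^ j) = 1 + r" by (simp add: p2 numeral_2_eq_2)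
  \<comment> \<open>For even \<open>c\<close> the exponent \<open>i = 0\<close> would be a
    root.\<close>
  have "odd c" using no_root[of 0] c h by auto
  have "?N dvd (r - 1) * (r + 1)" using rp by (simp add: p2 power2_eq_square algebra_simps)
  then have "?N dvd e * (2 * (r + 1))" using e by (simp add: algebra_simps)
  then have "?N dvd 2 * (r + 1)" using cop by (simp add: coprime_dvd_mult_right_iff coprime_commute)
  then obtain d where "2 * (r + 1) = ?N * d" by (elim dvdE)
  then have d: "r + 1 = h * d" using h by simp
  \<comment> \<open>At \<open>i = 1\<close> the exponent is \<open>r + 1 + m = h * (d + c)\<close>,
    which must not be a multiple of \<open>2 * h\<close>.\<close>
  have "even d"
  proof (rule ccontr)
    assume "odd d"
    then have "even (d + c)" using \<open>odd c\<close> by simp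
    then have "?N dvd h * (d + c)" using h by auto
    moreover have "1 * (\<Sum>j<p. r ^ j) + m = h * (d + c)" using d by (simp add: S c algebra_simps)
    ultimately show False using no_root[of 1] by metis
  qed
  then have rN: "?N dvd r + 1" using d h by auto
  then have "a [^] r = a [^] (-1::int)" using dvd_minus_iff[of ?N "r + 1"] by (simp add: eq algebra_simps)
  then show "x \<otimes> a = a [^] (-1::int) \<otimes> x" using xa by simp
  \<comment> \<open>For odd \<open>h\<close> the order of \<open>a\<close> would be 2, and the odd
    \<open>r\<close> would make \<open>x\<close> commute with \<open>a\<close>.\<close>
  have "even h"
  proof (rule ccontr)
    assume "odd h"
    then have "odd (2 ^ (k - 1) :: int)" using h \<open>k > 0\<close> by (cases k) (simp_all add: k p2)
    then have "k = 1" using \<open>k > 0\<close> by simp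
    then have "?N dvd r - 1" using k p2 pr by simp
    then show False using r by simp
  qed
  then have "4 dvd ?N" using h by auto
  then show "4 dvd ord a" by presburger
  have "?N dvd h - m" using \<open>odd c\<close> h unfolding c by (auto elim!: oddE simp: algebra_simps)
  then have "a [^] m = a [^] h" by (simp add: eq)
  then show "x \<otimes> x = a [^] (?N div 2)" using m xx h by simp
qed

theorem cyclic_or_generalized_quaternion:
  "cyclic_group G \<or> (p = 2 \<and> (\<exists>k\<ge>3. G \<cong> generalized_quaternion k))"
proof -
  obtain a where a: "a \<in> carrier G" and A: "range (\<lambda>i::int. a [^] i) \<lhd> G"
    and self_centralizing: "\<And>g. g \<in> carrier G \<Longrightarrow> g \<otimes> a = a \<otimes> g \<Longrightarrow> g \<in> range (\<lambda>i::int. a [^] i)"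
    using self_centralizing_cyclic_normal_subgroup by blast
  let ?A = "range (\<lambda>i::int. a [^] i)"
  interpret A: normal ?A G by fact
  note outside = outside_self_centralizing[OF a A self_centralizing]
  show ?thesis
  proof (cases "?A = carrier G")
    case True
    then show ?thesis using a cyclic_group by metis
  next
    case False
    have last: "\<exists>j. g [^] (p ^ j) \<notin> ?A \<and> (g [^] (p ^ j)) [^] p \<in> ?A" if "g \<in> carrier G" "g \<notin> ?A" for g
      using last_power_outside[OF A.one_closed that] that(1)
      by (metis nat_pow_pow power_Suc2)
    obtain g0 where "g0 \<in> carrier G" "g0 \<notin> ?A" using False A.subset by auto
    then obtain y where y: "y \<in> carrier G" "y \<notin> ?A" "y [^] p \<in> ?A"
      using last by (metis nat_pow_closed)
    have p2: "p = 2" and N4: "4 dvd ord a" by (rule outside[OF _ _ y]; assumption)+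
    have inverts: "g \<otimes> a = a [^] (-1::int) \<otimes> g" if g: "g \<in> carrier G" "g \<notin> ?A" for g
    proof -
      obtain j where j: "g [^] (p ^ j) \<notin> ?A" "(g [^] (p ^ j)) [^] p \<in> ?A" using last[OF g] by auto
      show ?thesis
      proof (cases j)
        case 0
        then show ?thesis using outside(3)[OF _ _ g] j g(1) by simp
      next
        case (Suc i)
        \<comment> \<open>For \<open>j > 0\<close> the inverting power of \<open>g\<close> is the
          square of \<open>z\<close>, which acts on \<open>a\<close> with exponent
          \<open>s ^ 2\<close>. This would give \<open>s ^ 2 = -1\<close> modulo the order of
          \<open>a\<close>, hence modulo 4.\<close>
        define z where "z = g [^] (p ^ i)"
        have z: "z \<in> carrier G" using g by (simp add: z_def)
        have zp: "z [^] p = g [^] (p ^ j)" using g(1) Suc by (simp add: z_def nat_pow_pow mult.commute)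
        have inv_z: "z [^] p \<otimes> a = a [^] (-1::int) \<otimes> z [^] p"
          using outside(3)[of "z [^] p"] j zp g(1) by simp
        have "z \<otimes> a \<otimes> inv z \<in> ?A" using A.inv_op_closed2[OF z] a by (metis int_pow_1 rangeI)
        then obtain s :: int where "z \<otimes> a \<otimes> inv z = a [^] s" by auto
        then have za: "z \<otimes> a = a [^] s \<otimes> z" using z a by (metis inv_solve_right int_pow_closed m_closed)
        have "a [^] (s ^ 2) \<otimes> z [^] p = a [^] (-1::int) \<otimes> z [^] p"
          using conj_pow_int_pow[OF z a za, of p] inv_z by (simp add: p2)
        then have "a [^] (-1::int) = a [^] (s ^ 2)" using a z by (metis int_pow_closed nat_pow_closed r_cancel)
        then have "int (ord a) dvd s ^ 2 + 1" using int_pow_eq[OF a] by simp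
        moreover have "4 dvd int (ord a)" using N4 by presburger
        ultimately have "4 dvd s ^ 2 + 1" using dvd_trans by blast
        moreover have "\<not> 4 dvd s ^ 2 + 1"
        proof (cases "even s")
          case True
          then show ?thesis by (auto elim!: evenE simp: power_mult_distrib) presburger
        next
          case False
          then obtain t where "s = 2 * t + 1" by (elim oddE)
          then have "s ^ 2 + 1 = 4 * (t * t + t) + 2" by (simp add: power2_eq_square algebra_simps)
          then show ?thesis by presburger
        qed
        ultimately show ?thesis by simp
      qed
    qed
    have "ord a dvd p ^ n" using pow_order[OF a] by (simp add: pow_eq_id a)
    then obtain k where k: "ord a = 2 ^ k" using prime_p divides_primepow_nat p2 by blast
    \<comment> \<open>The powers of \<open>a\<close> will have index 2, so the quaternion parameter
      is \<open>Suc k\<close>, and it has to be at least 3.\<close>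
    have "k \<ge> 2"
    proof (rule ccontr)
      assume "\<not> k \<ge> 2"
      then have "k = 0 \<or> k = 1" by auto
      then show False using N4 k by auto
    qed
    then obtain l where l: "k = Suc (Suc l)" by (metis add_2_eq_Suc le_Suc_ex)
    have "G \<cong> generalized_quaternion (Suc k)"
    proof (rule iso_generalized_quaternion[OF a y(1)])
      show "y \<otimes> y = a [^] (2 ^ (Suc k - 2) :: int)"
        using outside(4)[OF _ _ y] by (simp add: k l)
      show "y \<otimes> a = a [^] (-1::int) \<otimes> y" by (rule inverts[OF y(1,2)])
      show "y \<notin> ?A" by (rule y)
      fix g assume g: "g \<in> carrier G" "g \<notin> ?A"
      \<comment> \<open>Two inversions cancel: \<open>g \<otimes> y\<close> centralizes
        \<open>a\<close> and therefore lies in \<open>A\<close>.\<close>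
      have "g \<otimes> y \<otimes> a = g \<otimes> a [^] (-1::int) \<otimes> y"
        using g a y by (simp add: inverts[OF y(1,2)] m_assoc)
      also have "g \<otimes> a [^] (-1::int) = a \<otimes> g"
        using conj_int_pow[OF g(1) a inverts[OF g], of "-1"] a by simp
      finally have "g \<otimes> y \<otimes> a = a \<otimes> (g \<otimes> y)" using g a y by (simp add: m_assoc)
      then show "g \<otimes> y \<in> ?A" using self_centralizing g y by simp
    qed (use k \<open>k \<ge> 2\<close> in auto)
    then show ?thesis using p2 \<open>k \<ge> 2\<close> by (intro disjI2 conjI exI[of _ "Suc k"]) auto
  qed
qed

end

section \<open>Groups with bipartite intersection subgroup graph\<close>

text \<open>Equivalently, every non-trivial subgroup meets \<open>M\<close>.\<close>

definition power_covered :: "('a, 'b) monoid_scheme \<Rightarrow> 'a set \<Rightarrow> bool" where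
  "power_covered G M \<longleftrightarrow> M \<subseteq> carrier G - {\<one>\<^bsub>G\<^esub>} \<and>
     (\<forall>x \<in> carrier G - {\<one>\<^bsub>G\<^esub>}. \<exists>k::nat. x [^]\<^bsub>G\<^esub> k \<in> M)"

section \<open>Elements reached by powers, and sufficiency of the listed groups\<close>

lemma power_covered_iso:
  assumes "group G" "group H" "f \<in> iso H G" "power_covered H M"
  shows "power_covered G (f ` M)"
proof -
  interpret f: group_hom H G f
    using assms by (auto simp: group_hom_def group_hom_axioms_def iso_def)
  have inj: "inj_on f (carrier H)" and surj: "f ` carrier H = carrier G"
    using assms(3) by (auto simp: iso_def bij_betw_def)
  have one: "f u = \<one>\<^bsub>G\<^esub> \<longleftrightarrow> u = \<one>\<^bsub>H\<^esub>" if "u \<in> carrier H" for u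
    using inj that f.hom_one by (metis f.G.one_closed inj_onD)
  show ?thesis unfolding power_covered_def
  proof (intro conjI ballI)
    show "f ` M \<subseteq> carrier G - {\<one>\<^bsub>G\<^esub>}"
      using assms(4) one by (auto simp: power_covered_def)
    fix x assume "x \<in> carrier G - {\<one>\<^bsub>G\<^esub>}"
    then have x: "x \<in> f ` carrier H" "x \<noteq> \<one>\<^bsub>G\<^esub>" using surj by simp_all
    then obtain u where u: "x = f u" "u \<in> carrier H" by (elim imageE)
    moreover have "u \<noteq> \<one>\<^bsub>H\<^esub>" using one[OF u(2)] u(1) x(2) by simp
    ultimately have u: "u \<in> carrier H" "u \<noteq> \<one>\<^bsub>H\<^esub>" "x = f u" by simp_all
    then obtain k :: nat where "u [^]\<^bsub>H\<^esub> k \<in> M" using assms(4) by (auto simp: power_covered_def)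
    then have "f (u [^]\<^bsub>H\<^esub> k) \<in> f ` M" by (rule imageI)
    then show "\<exists>k::nat. x [^]\<^bsub>G\<^esub> k \<in> f ` M" using u f.hom_nat_pow by metis
  qed
qed

text \<open>Raising a pair to the order of \<open>H\<close> kills the second component but, the
  orders being coprime, not a non-trivial first one; a further power then lands in \<open>M\<close>.
  If the first component is trivial, the second is used.\<close>

lemma power_covered_DirProd:
  assumes "group G" "group H" "finite (carrier G)" "finite (carrier H)"
    and cop: "coprime (order G) (order H)"
    and M: "power_covered G M" and N: "power_covered H N"
  shows "power_covered (G \<times>\<times> H) (M \<times> {\<one>\<^bsub>H\<^esub>} \<union> {\<one>\<^bsub>G\<^esub>} \<times> N)"
proof -
  interpret G: group G by fact
  interpret H: group H by fact
  have pow: "(x, y) [^]\<^bsub>G \<times>\<times> H\<^esub> k = (x [^]\<^bsub>G\<^esub> k, y [^]\<^bsub>H\<^esub> k)" for x y and k :: nat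
    by (induction k) simp_all
  have nontrivial: "x [^]\<^bsub>K\<^esub> n \<noteq> \<one>\<^bsub>K\<^esub>"
    if "group K" "x \<in> carrier K" "x \<noteq> \<one>\<^bsub>K\<^esub>" "coprime (order K) n" for K :: "('x, 'y) monoid_scheme" and x n
  proof
    interpret K: group K by fact
    assume "x [^]\<^bsub>K\<^esub> n = \<one>\<^bsub>K\<^esub>"
    then have "K.ord x dvd n" using that by (simp add: K.pow_eq_id)
    moreover have "K.ord x dvd order K" using that by (simp add: K.ord_dvd_group_order)
    ultimately have "K.ord x = 1" using that(4) by (metis coprime_common_divisor_nat)
    then show False using K.ord_eq_1[OF that(2)] that(3) by simp
  qed
  show ?thesis unfolding power_covered_def
  proof (intro conjI ballI)
    show "M \<times> {\<one>\<^bsub>H\<^esub>} \<union> {\<one>\<^bsub>G\<^esub>} \<times> N \<subseteq> carrier (G \<times>\<times> H) - {\<one>\<^bsub>G \<times>\<times> H\<^esub>}"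
      using M N by (auto simp: power_covered_def)
    fix z assume "z \<in> carrier (G \<times>\<times> H) - {\<one>\<^bsub>G \<times>\<times> H\<^esub>}"
    then obtain x y where z: "z = (x, y)" "x \<in> carrier G" "y \<in> carrier H" "x \<noteq> \<one>\<^bsub>G\<^esub> \<or> y \<noteq> \<one>\<^bsub>H\<^esub>" by auto
    have one: "y [^]\<^bsub>H\<^esub> order H = \<one>\<^bsub>H\<^esub>" "x [^]\<^bsub>G\<^esub> order G = \<one>\<^bsub>G\<^esub>"
      using z by (simp_all add: H.pow_order_eq_1 G.pow_order_eq_1)
    show "\<exists>k::nat. z [^]\<^bsub>G \<times>\<times> H\<^esub> k \<in> M \<times> {\<one>\<^bsub>H\<^esub>} \<union> {\<one>\<^bsub>G\<^esub>} \<times> N"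
    proof (cases "x = \<one>\<^bsub>G\<^esub>")
      case False
      have "x [^]\<^bsub>G\<^esub> order H \<noteq> \<one>\<^bsub>G\<^esub>" by (rule nontrivial[OF assms(1) z(2) False cop])
      then obtain k :: nat where "(x [^]\<^bsub>G\<^esub> order H) [^]\<^bsub>G\<^esub> k \<in> M"
        using M z(2) by (auto simp: power_covered_def)
      moreover have "y [^]\<^bsub>H\<^esub> (order H * k) = \<one>\<^bsub>H\<^esub>"
        using z one(1) H.nat_pow_pow[of y "order H" k] by simp
      ultimately show ?thesis
        using z(2) by (intro exI[of _ "order H * k"]) (simp add: z(1) pow G.nat_pow_pow)
    next
      case True
      then have "y [^]\<^bsub>H\<^esub> order G \<noteq> \<one>\<^bsub>H\<^esub>"
        using z(3,4) cop by (intro nontrivial assms(2)) (simp_all add: coprime_commute)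
      then obtain k :: nat where "(y [^]\<^bsub>H\<^esub> order G) [^]\<^bsub>H\<^esub> k \<in> N"
        using N z(3) by (auto simp: power_covered_def)
      then show ?thesis
        using z(3) True by (intro exI[of _ "order G * k"]) (simp add: z(1) pow H.nat_pow_pow)
    qed
  qed
qed

text \<open>A cyclic group has one subgroup of order \<open>p\<close>, so a single generator
  \<open>a\<close> of it is reached from every \<open>x\<close> whose order \<open>p\<close>
  divides.\<close>

lemma (in group) cyclic_power_of_prime_order:
  assumes fin: "finite (carrier G)" and cyc: "cyclic_group G"
    and p: "Factorial_Ring.prime p" "p dvd order G"
  obtains a where "a \<in> carrier G" "a \<noteq> \<one>"
    "\<And>x. x \<in> carrier G \<Longrightarrow> p dvd ord x \<Longrightarrow> \<exists>k::nat. x [^] k = a"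
proof -
  obtain g where g: "g \<in> carrier G" and G: "carrier G = range (\<lambda>i::int. g [^] i)"
    using cyc by (auto simp: cyclic_group)
  have "carrier G = generate G {g}" unfolding G using g by (auto simp: generate_pow)
  then have ord_g: "ord g = order G" using generate_pow_card[OF g] by (simp add: order_def)
  obtain m where m: "order G = p * m" using p(2) by (elim dvdE)
  have pos: "p * m > 0" using ord_ge_1[OF fin g] ord_g m by simp
  define a where "a = g [^] m"
  have a: "a \<in> carrier G" using g by (simp add: a_def)
  have "ord a = p" using ord_pow[OF g, of m] ord_g m pos by (simp add: a_def)
  then have a_nontrivial: "a \<noteq> \<one>" using p(1) by auto
  have a_p: "a [^] p = \<one>" using a \<open>ord a = p\<close> pow_ord_eq_1 by metis
  have "\<exists>k::nat. x [^] k = a" if x: "x \<in> carrier G" "p dvd ord x" for x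
  proof -
    obtain l where l: "ord x = p * l" using x(2) by (elim dvdE)
    have l_pos: "l > 0" using ord_ge_1[OF fin x(1)] l by (cases l) auto
    define y where "y = x [^] l"
    have y: "y \<in> carrier G" using x by (simp add: y_def)
    have "ord y = p" using ord_pow[OF x(1), of l] l l_pos by (simp add: y_def)
    then have y_nontrivial: "y \<noteq> \<one>" using p(1) by auto
    have y_p: "y [^] p = \<one>" using \<open>ord y = p\<close> pow_ord_eq_1[OF y] by simp
    obtain i :: int where i: "y = g [^] i" using y G by auto
    \<comment> \<open>A trivial \<open>p\<close>-th power forces \<open>i\<close> to be a multiple
      of \<open>m\<close>, which makes \<open>y\<close> a power of \<open>a\<close>.\<close>
    have "g [^] (i * int p) = \<one>" using y_p i g int_pow_pow[OF g, of i "int p"] by (simp add: int_pow_int)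
    then have "int (p * m) dvd i * int p" using int_pow_eq_id[OF g] ord_g m by simp
    then have "int m dvd i" using p(1) by (auto simp: mult.commute prime_gt_0_nat)
    then obtain c where c: "i = int m * c" by (elim dvdE)
    have yc: "y = a [^] c" using i c int_pow_pow[OF g, of "int m" c] by (simp add: a_def int_pow_int)
    have "\<not> int p dvd c" using y_nontrivial int_pow_eq_id[OF a] \<open>ord a = p\<close> yc by simp
    then have "coprime c (int p)" using prime_imp_coprime[of "int p" c] p(1) by (simp add: coprime_commute)
    then obtain u :: int where "(a [^] c) [^] u = a" using coprime_int_pow_generates[OF a a_p] by metis
    then have "y [^] u = a" by (simp add: yc)
    \<comment> \<open>The Bezout exponent may be negative, whereas \<open>power_covered\<close> asks
      for a natural one.\<close>
    moreover have "y [^] (u mod int p) = y [^] u"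
      using int_pow_eq[OF y] \<open>ord y = p\<close> by (simp add: mod_eq_dvd_iff flip: mod_eq_dvd_iff)
    moreover have "u mod int p = int (nat (u mod int p))" using p(1) by (simp add: prime_gt_0_nat)
    ultimately have "y [^] nat (u mod int p) = a" by (metis int_pow_int)
    then show ?thesis using x(1) by (auto simp: y_def nat_pow_pow)
  qed
  then show thesis using that a a_nontrivial by blast
qed

text \<open>One element of each prime order suffices, since a non-trivial element has an order
  divisible by some prime in \<open>P\<close>.\<close>

lemma (in group) cyclic_power_covered:
  assumes fin: "finite (carrier G)" and cyc: "cyclic_group G"
    and P: "finite P" "\<And>p. p \<in> P \<Longrightarrow> Factorial_Ring.prime p \<and> p dvd order G"
    "\<And>p. Factorial_Ring.prime p \<Longrightarrow> p dvd order G \<Longrightarrow> p \<in> P"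
  obtains M where "power_covered G M" "finite M" "card M \<le> card P"
proof -
  have "\<exists>a. a \<in> carrier G \<and> a \<noteq> \<one> \<and> (\<forall>x\<in>carrier G. p dvd ord x \<longrightarrow> (\<exists>k::nat. x [^] k = a))" if "p \<in> P" for p
    using cyclic_power_of_prime_order[OF fin cyc] P(2)[OF that] by metis
  then obtain f where f: "\<And>p. p \<in> P \<Longrightarrow> f p \<in> carrier G \<and> f p \<noteq> \<one> \<and>
      (\<forall>x\<in>carrier G. p dvd ord x \<longrightarrow> (\<exists>k::nat. x [^] k = f p))"
    by metis
  have "\<exists>k::nat. x [^] k \<in> f ` P" if x: "x \<in> carrier G" "x \<noteq> \<one>" for x
  proof -
    have "ord x \<noteq> 1" using ord_eq_1[OF x(1)] x(2) by simp
    then obtain p where p: "Factorial_Ring.prime p" "p dvd ord x" using prime_factor_nat by blast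
    then have "p dvd order G" using ord_dvd_group_order[OF x(1)] dvd_trans by blast
    then have "p \<in> P" using P(3) p(1) by blast
    then show ?thesis using f p(2) x(1) by (metis imageI)
  qed
  then have "power_covered G (f ` P)" using f by (auto simp: power_covered_def)
  then show thesis using that P(1) card_image_le by blast
qed

text \<open>The element is the central involution. Every \<open>(i, True)\<close> squares to it, and
  for \<open>i = 2 ^ e * c\<close> with \<open>c\<close> odd the exponent
  \<open>2 ^ (n - 2 - e)\<close> turns \<open>i\<close> into an odd multiple of
  \<open>2 ^ (n - 2)\<close>, which is \<open>2 ^ (n - 2)\<close> modulo
  \<open>2 ^ (n - 1)\<close>.\<close>

lemma power_covered_generalized_quaternion:
  assumes "n \<ge> 3"
  shows "power_covered (generalized_quaternion n) {(2 ^ (n - 2), False)}"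
proof -
  let ?Q = "generalized_quaternion n"
  define k where "k = n - 3"
  have k: "n = Suc (Suc (Suc k))" using assms by (simp add: k_def)
  have pow: "(i, False) [^]\<^bsub>?Q\<^esub> m = ((int m * i) mod 2 ^ (n - 1), False)" for i and m :: nat
    by (induction m) (auto simp: generalized_quaternion_def mod_simps algebra_simps)
  interpret Q: group ?Q by (rule group_generalized_quaternion[OF assms])
  show ?thesis unfolding power_covered_def
  proof (intro conjI ballI)
    show "{(2 ^ (n - 2), False)} \<subseteq> carrier ?Q - {\<one>\<^bsub>?Q\<^esub>}"
      by (auto simp: generalized_quaternion_def k)
    fix x assume x: "x \<in> carrier ?Q - {\<one>\<^bsub>?Q\<^esub>}"
    obtain i b where ib: "x = (i, b)" by fastforce
    show "\<exists>m::nat. x [^]\<^bsub>?Q\<^esub> m \<in> {(2 ^ (n - 2), False)}"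
    proof (cases b)
      case True
      have "x [^]\<^bsub>?Q\<^esub> (2::nat) = x \<otimes>\<^bsub>?Q\<^esub> x" using x by (simp add: numeral_2_eq_2)
      also have "\<dots> = (2 ^ (n - 2), False)" using True by (simp add: ib generalized_quaternion_def k)
      finally show ?thesis by blast
    next
      case False
      then have i: "0 < i" "i < 2 ^ (n - 1)" using x by (auto simp: ib generalized_quaternion_def)
      define e where "e = multiplicity 2 i"
      obtain c where c: "i = 2 ^ e * c" "\<not> 2 dvd c"
        unfolding e_def by (rule multiplicity_decompose'[of i 2]) (use i in auto)
      have c_pos: "c > 0" using c i by (simp add: zero_less_mult_iff)
      have "(2::int) ^ e \<le> i" using c c_pos by simp
      then have "(2::int) ^ e < 2 ^ (n - 1)" using i(2) by (rule le_less_trans)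
      then have e: "e < n - 1" by (rule power_less_imp_less_exp[rotated]) simp
      define d where "d = n - 2 - e"
      have d: "n - 2 = e + d" using e by (simp add: d_def)
      have n1: "n - 1 = Suc (e + d)" using d k by simp
      obtain t where t: "c = 2 * t + 1" using c(2) by (auto elim: oddE)
      have "int (2 ^ d) * i = 2 ^ (e + d) + 2 ^ (n - 1) * t"
        unfolding n1 by (simp add: c(1) t power_add algebra_simps)
      then have "(int (2 ^ d) * i) mod 2 ^ (n - 1) = 2 ^ (e + d) mod 2 ^ (n - 1)" by simp
      also have "\<dots> = 2 ^ (e + d)" unfolding n1 by simp
      finally have "x [^]\<^bsub>?Q\<^esub> (2 ^ d :: nat) = (2 ^ (n - 2), False)"
        using False by (simp only: ib pow d)
      then show ?thesis by blast
    qed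
  qed
qed

text \<open>One part consists of the vertices containing \<open>a\<close>. Two vertices in the other
  part both contain \<open>b\<close>, so they are not adjacent.\<close>

lemma (in group) bipartite_if_power_covered:
  assumes M: "power_covered G M" "finite M" "card M \<le> 2"
  shows "bipartite (intersection_subgroup_graph G)"
proof -
  have meets: "H \<inter> M \<noteq> {}" if H: "subgroup H G" "H \<noteq> {\<one>}" for H
  proof -
    obtain x where x: "x \<in> H" "x \<noteq> \<one>" using H subgroup.one_closed[OF H(1)] by blast
    then have "x \<in> carrier G - {\<one>}" using subgroup.subset[OF H(1)] by auto
    then obtain k :: nat where "x [^] k \<in> M" using M(1) unfolding power_covered_def by blast
    moreover have "x [^] k \<in> H" using subgroup_int_pow_closed[OF H(1) x(1), of "int k"] by (simp add: int_pow_int)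
    ultimately show ?thesis by blast
  qed
  have one: "\<one> \<notin> M" using M(1) by (auto simp: power_covered_def)
  \<comment> \<open>\<open>a\<close> and \<open>b\<close> may coincide; if \<open>M\<close> is empty
    they are arbitrary, and then the graph has no vertices.\<close>
  obtain a b where ab: "M \<subseteq> {a, b}" "a \<in> M \<or> M = {}" "b \<in> M \<or> M = {}"
  proof -
    consider "card M = 0" | "card M = 1" | "card M = 2" using M(3) by linarith
    then show thesis
    proof cases
      case 1
      then have "M = {}" using M(2) by simp
      then show thesis using that by simp
    next
      case 2
      then obtain c where "M = {c}" by (auto simp: card_1_singleton_iff)
      then show thesis using that[of c c] by simp
    next
      case 3
      then obtain c d where "M = {c, d}" by (auto simp: card_2_iff)
      then show thesis using that[of c d] by simp
    qed
  qed
  define V where "V = pverts (intersection_subgroup_graph G)"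
  have V: "subgroup H G \<and> H \<inter> M \<noteq> {}" if "H \<in> V" for H
    using that meets by (auto simp: V_def intersection_subgroup_graph_def Let_def)
  have "parcs (intersection_subgroup_graph G) \<subseteq>
      {H \<in> V. a \<in> H} \<times> {H \<in> V. a \<notin> H} \<union> {H \<in> V. a \<notin> H} \<times> {H \<in> V. a \<in> H}"
  proof (rule subrelI)
    fix H K assume "(H, K) \<in> parcs (intersection_subgroup_graph G)"
    then have HK: "H \<in> V" "K \<in> V" "H \<inter> K = {\<one>}"
      by (auto simp: V_def intersection_subgroup_graph_def Let_def)
    moreover have "a \<in> H \<or> b \<in> H" "a \<in> K \<or> b \<in> K" "a \<in> M" "b \<in> M"
      using V[OF HK(1)] V[OF HK(2)] ab by auto
    moreover have "\<not> (a \<in> H \<and> a \<in> K)" "\<not> (b \<in> H \<and> b \<in> K)"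
      using HK(3) one \<open>a \<in> M\<close> \<open>b \<in> M\<close> by (metis IntI singletonD)+
    ultimately show "(H, K) \<in> {H \<in> V. a \<in> H} \<times> {H \<in> V. a \<notin> H} \<union> {H \<in> V. a \<notin> H} \<times> {H \<in> V. a \<in> H}"
      by auto
  qed
  then show ?thesis
    unfolding bipartite_def V_def[symmetric]
    by (intro exI[of _ "{H \<in> V. a \<in> H}"] exI[of _ "{H \<in> V. a \<notin> H}"]) auto
qed

lemma cyclic_integer_mod_group: "cyclic_group (integer_mod_group n)"
proof -
  interpret group "integer_mod_group n" by simp
  show ?thesis
  \<comment> \<open>The generator is 1, which for \<open>n = 1\<close> is not in the carrier
    \<open>{0}\<close>.\<close>
  proof (cases "n = 1")
    case True
    then show ?thesis by (simp add: trivial_imp_cyclic_group trivial_integer_mod_group)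
  next
    case False
    have "i \<in> range (\<lambda>k::int. 1 [^]\<^bsub>integer_mod_group n\<^esub> k)" if "i \<in> carrier (integer_mod_group n)" for i
      using that by (intro image_eqI[of _ _ i])
        (auto simp: int_pow_integer_mod_group carrier_integer_mod_group split: if_splits)
    moreover have "1 [^]\<^bsub>integer_mod_group n\<^esub> (k::int) \<in> carrier (integer_mod_group n)" for k
      using False by (intro int_pow_closed) simp
    ultimately show ?thesis using False by (auto simp: cyclic_group intro!: bexI[of _ 1])
  qed
qed

lemma order_integer_mod_group: "n > 0 \<Longrightarrow> order (integer_mod_group n) = n"
  by (simp add: order_def carrier_integer_mod_group)

context group
begin

text \<open>Allowing \<open>p = q\<close> treats prime powers together with products of two prime
  powers.\<close>

lemma bipartite_cyclic:
  assumes fin: "finite (carrier G)" and cyc: "cyclic_group G"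
    and pq: "\<And>r. Factorial_Ring.prime r \<Longrightarrow> r dvd order G \<Longrightarrow> r = p \<or> r = q"
  shows "bipartite (intersection_subgroup_graph G)"
proof -
  let ?P = "{r. Factorial_Ring.prime r \<and> r dvd order G}"
  have sub: "?P \<subseteq> {p, q}" using pq by auto
  then have P: "finite ?P" by (rule finite_subset) simp
  obtain M where "power_covered G M" "finite M" "card M \<le> card ?P"
    using cyclic_power_covered[OF fin cyc P] by blast
  moreover have "card ?P \<le> card {p, q}" using sub by (intro card_mono) auto
  moreover have "card {p, q} \<le> 2" by (simp add: card_insert_if)
  ultimately show ?thesis by (intro bipartite_if_power_covered) auto
qed

lemma bipartite_iso:
  assumes "group H" "G \<cong> H" "power_covered H M" "finite M" "card M \<le> 2"
  shows "bipartite (intersection_subgroup_graph G)"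
proof -
  obtain f where "f \<in> iso H G" using iso_sym[OF assms(2)] by (auto simp: is_iso_def)
  then have "power_covered G (f ` M)" by (intro power_covered_iso[OF is_group assms(1)] assms)
  moreover have "card (f ` M) \<le> 2" using card_image_le[OF assms(4), of f] assms(5) by simp
  ultimately show ?thesis using assms(4) by (intro bipartite_if_power_covered) auto
qed

section \<open>Necessity: triangles of subgroups of prime order\<close>

lemma subgroups_prime_card_disjoint:
  assumes fin: "finite (carrier G)" and H: "subgroup H G" and K: "subgroup K G"
    and p: "Factorial_Ring.prime (card H)" and q: "Factorial_Ring.prime (card K)" and "H \<noteq> K"
  shows "H \<inter> K = {\<one>}"
proof -
  have HK: "subgroup (H \<inter> K) G" by (rule subgroups_Inter_pair[OF H K])
  have dvd: "card (H \<inter> K) dvd card L" if "subgroup L G" "H \<inter> K \<subseteq> L" for L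
    using group.lagrange[OF subgroup.subgroup_is_group[OF that(1) is_group] subgroup_incl[OF HK that]]
    by (metis dvd_triv_right order_def partial_object.select_convs(1) partial_object.surjective partial_object.update_convs(1))
  have fin': "finite H" "finite K"
    using H K fin subgroup.subset by (auto intro: finite_subset)
  have "card (H \<inter> K) dvd card H" "card (H \<inter> K) dvd card K" using dvd H K by auto
  then consider "card (H \<inter> K) = 1" | "card (H \<inter> K) = card H" "card (H \<inter> K) = card K"
    using p q by (metis prime_nat_iff)
  then show ?thesis
  proof cases
    case 1
    then obtain c where "H \<inter> K = {c}" by (rule card_1_singletonE)
    then show ?thesis using subgroup.one_closed[OF HK] by (metis singletonD)
  next
    case 2
    then have "H \<inter> K = H" "H \<inter> K = K"
      using card_subset_eq[OF fin'(1) Int_lower1] card_subset_eq[OF fin'(2) Int_lower2] by simp_all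
    then show ?thesis using \<open>H \<noteq> K\<close> by simp
  qed
qed

lemma bipartite_three_prime_subgroups:
  assumes fin: "finite (carrier G)" and bip: "bipartite (intersection_subgroup_graph G)"
    and H: "subgroup H G" "Factorial_Ring.prime (card H)"
    and K: "subgroup K G" "Factorial_Ring.prime (card K)"
    and L: "subgroup L G" "Factorial_Ring.prime (card L)"
  shows "H = K \<or> K = L \<or> H = L"
proof (rule ccontr)
  assume "\<not> ?thesis"
  then have ne: "H \<noteq> K" "K \<noteq> L" "H \<noteq> L" by auto
  have disj: "H \<inter> K = {\<one>}" "K \<inter> L = {\<one>}" "H \<inter> L = {\<one>}"
    using subgroups_prime_card_disjoint[OF fin] H K L ne by auto
  have nt: "H \<noteq> {\<one>}" "K \<noteq> {\<one>}" "L \<noteq> {\<one>}" using H K L by (auto dest!: arg_cong[of _ _ card])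
  let ?E = "parcs (intersection_subgroup_graph G)"
  let ?V = "pverts (intersection_subgroup_graph G)"
  have mem: "A \<in> ?V"
    if "subgroup A G" "A \<noteq> {\<one>}" "subgroup B G" "B \<noteq> {\<one>}" "A \<inter> B = {\<one>}" for A B
    using that by (simp add: intersection_subgroup_graph_def Let_def) blast
  have E_mem: "(A, B) \<in> ?E" if "A \<in> ?V" "B \<in> ?V" "A \<noteq> B" "A \<inter> B = {\<one>}" for A B
    using that by (simp add: intersection_subgroup_graph_def Let_def)
  have V: "H \<in> ?V" "K \<in> ?V" "L \<in> ?V"
    using mem[OF H(1) nt(1) K(1) nt(2) disj(1)] mem[OF K(1) nt(2) L(1) nt(3) disj(2)]
      mem[OF L(1) nt(3) K(1) nt(2)] disj(2) by (simp_all add: Int_commute)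
  have E: "(H, K) \<in> ?E" "(K, L) \<in> ?E" "(H, L) \<in> ?E"
    using E_mem V ne disj by simp_all
  obtain U W where "U \<inter> W = {}" "?E \<subseteq> U \<times> W \<union> W \<times> U" using bip by (auto simp: bipartite_def)
  then show False using E by blast
qed

lemma card_generate_prime:
  assumes fin: "finite (carrier G)" and "Factorial_Ring.prime (p::nat)" "x \<in> carrier G" "x \<noteq> \<one>" "x [^] p = \<one>"
  shows "subgroup (generate G {x}) G" "card (generate G {x}) = p" "x \<in> generate G {x}"
proof -
  show "subgroup (generate G {x}) G" using assms by (intro generate_is_subgroup) simp
  have "ord x dvd p" using assms by (simp add: pow_eq_id)
  then have "ord x = p" using assms(2,4) ord_eq_1[OF assms(3)] by (auto simp: prime_nat_iff)
  then show "card (generate G {x}) = p" using generate_pow_card[OF assms(3)] by simp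
  show "x \<in> generate G {x}" by (simp add: generate.incl)
qed

text \<open>If \<open>h\<close> has order \<open>p\<close> and lies outside the subgroup generated
  by a central \<open>z\<close> of order \<open>p\<close>, then \<open>z\<close>, \<open>h\<close>
  and \<open>z \<otimes> h\<close> generate three different subgroups of order
  \<open>p\<close>.\<close>

lemma bipartite_p_group_unique_subgroup:
  assumes nil: "nilpotent_group G" and bip: "bipartite (intersection_subgroup_graph G)"
    and p: "Factorial_Ring.prime p" and order: "order G = p ^ n" and n: "n \<ge> 1"
  shows "p_group_unique_subgroup G p n"
proof -
  have fin: "finite (carrier G)"
    using order p by (metis order_def card.infinite power_not_zero not_prime_0)
  have "order G \<noteq> 1" using order p n by (auto simp: prime_nat_iff)
  have "\<not> carrier G \<subseteq> {\<one>}"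
  proof
    assume "carrier G \<subseteq> {\<one>}"
    then have "carrier G = {\<one>}" by auto
    then show False using \<open>order G \<noteq> 1\<close> by (simp add: order_def)
  qed
  then obtain x where x: "x \<in> carrier G" "x \<noteq> \<one>"
    and x_comm: "\<And>g. g \<in> carrier G \<Longrightarrow> x \<otimes> g \<otimes> inv x \<otimes> inv g = \<one>"
    using nilpotent_central_mod[OF nil normal_self, of "{\<one>}"] by auto
  have "ord x dvd p ^ n" using ord_dvd_group_order[OF x(1)] order by simp
  then obtain k where k: "ord x = p ^ k" using p divides_primepow_nat by blast
  have "k > 0" using k x ord_eq_1[OF x(1)] by (cases k) auto
  then have px: "ord x = p ^ (k - 1) * p" using k by (cases k) auto
  define z where "z = x [^] (p ^ (k - 1))"
  have z: "z \<in> carrier G" using x by (simp add: z_def)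
  have "ord z = p" using ord_pow[OF x(1), of "p ^ (k - 1)"] px p by (simp add: z_def prime_gt_0_nat)
  then have z_p: "z [^] p = \<one>" and z1: "z \<noteq> \<one>" using pow_ord_eq_1[OF z] p by auto
  have x_central: "x \<otimes> g = g \<otimes> x" if g: "g \<in> carrier G" for g
    
  proof -
    have "x \<otimes> g = (x \<otimes> g \<otimes> inv x \<otimes> inv g) \<otimes> (g \<otimes> x)"
      using x(1) g by (simp add: m_assoc inv_mult_cancel)
    then show ?thesis using x_comm[OF g] x(1) g by simp
  qed
  have z_central: "z \<otimes> g = g \<otimes> z" if g: "g \<in> carrier G" for g
    unfolding z_def using x_central[OF g] x(1) g by (rule group_commutes_pow)
  let ?Z = "generate G {z}"
  note Z = card_generate_prime[OF fin p z z1 z_p]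
  \<comment> \<open>Applied to \<open>H\<close>, \<open>K\<close> in both orders, this makes two
    supposedly distinct subgroups both equal to \<open>?Z\<close>.\<close>
  have *: "H = ?Z" if H: "subgroup H G" "card H = p" and K: "subgroup K G" "card K = p" and "H \<noteq> K" for H K
  proof (rule ccontr)
    assume HZ: "H \<noteq> ?Z"
    have HZ1: "H \<inter> ?Z = {\<one>}"
      using subgroups_prime_card_disjoint[OF fin H(1) Z(1)] H(2) Z(2) p HZ by simp
    have "H \<noteq> {\<one>}" using H(2) p by auto
    then obtain h where h: "h \<in> H" "h \<noteq> \<one>" using subgroup.one_closed[OF H(1)] by blast
    have hc: "h \<in> carrier G" using h(1) subgroup.subset[OF H(1)] by auto
    interpret HG: group "G\<lparr>carrier := H\<rparr>" by (rule subgroup.subgroup_is_group[OF H(1) is_group])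
    have "h [^] p = \<one>"
      using HG.pow_order_eq_1[of h] h(1) H(2) by (simp add: order_def nat_pow_def)
    then have zh_p: "(z \<otimes> h) [^] p = \<one>"
      using z_central[OF hc] z hc z_p by (simp add: pow_mult_distrib)
    have zh: "z \<otimes> h \<in> carrier G" using z hc by simp
    have h_notin: "h \<notin> ?Z" using HZ1 h by auto
    have z_notin: "z \<notin> H" using HZ1 Z(3) z1 by auto
    have zh_Z: "z \<otimes> h \<notin> ?Z"
    proof
      assume "z \<otimes> h \<in> ?Z"
      then have "inv z \<otimes> (z \<otimes> h) \<in> ?Z"
        by (rule subgroup.m_closed[OF Z(1) subgroup.m_inv_closed[OF Z(1,3)]])
      then show False using h_notin inv_mult_cancel[OF z hc] by simp
    qed
    have zh_H: "z \<otimes> h \<notin> H"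
    proof
      assume "z \<otimes> h \<in> H"
      then have "(z \<otimes> h) \<otimes> inv h \<in> H"
        using subgroup.m_closed[OF H(1) _ subgroup.m_inv_closed[OF H(1) h(1)]] by simp
      then show False using z_notin z hc by (simp add: m_assoc)
    qed
    have "z \<otimes> h \<noteq> \<one>" using zh_H subgroup.one_closed[OF H(1)] by metis
    note L = card_generate_prime[OF fin p zh this zh_p]
    have "H = ?Z \<or> ?Z = generate G {z \<otimes> h} \<or> H = generate G {z \<otimes> h}"
      using bipartite_three_prime_subgroups[OF fin bip H(1) _ Z(1) _ L(1)] H(2) Z(2) L(2) p by simp
    then show False using HZ L(3) zh_Z zh_H by metis
  qed
  show ?thesis
  proof unfold_locales
    fix H K assume "subgroup H G" "subgroup K G" "card H = p" "card K = p"
    then show "H = K" using *[of H K] *[of K H] by metis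
  qed (use p order nil in auto)
qed

section \<open>Direct products and the case of two primes\<close>

lemma iso_DirProd_subgroups:
  assumes fin: "finite (carrier G)" and P: "subgroup P G" and Q: "subgroup Q G"
    and comm: "\<And>x y. x \<in> P \<Longrightarrow> y \<in> Q \<Longrightarrow> x \<otimes> y = y \<otimes> x"
    and PQ: "P \<inter> Q = {\<one>}" and card: "order G = card P * card Q"
  shows "G\<lparr>carrier := P\<rparr> \<times>\<times> G\<lparr>carrier := Q\<rparr> \<cong> G"
proof -
  interpret P: subgroup P G by fact
  interpret Q: subgroup Q G by fact
  let ?f = "\<lambda>(x, y). x \<otimes> y"
  have inj: "inj_on ?f (P \<times> Q)"
  proof (rule inj_onI)
    fix u v assume "u \<in> P \<times> Q" "v \<in> P \<times> Q" "?f u = ?f v"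
    then obtain x y x' y' where uv: "u = (x, y)" "v = (x', y')" "x \<in> P" "y \<in> Q" "x' \<in> P" "y' \<in> Q"
      and eq: "x \<otimes> y = x' \<otimes> y'" by auto
    then have c: "x \<in> carrier G" "y \<in> carrier G" "x' \<in> carrier G" "y' \<in> carrier G" by auto
    have "inv x' \<otimes> x = y' \<otimes> inv y"
    proof -
      have "inv x' \<otimes> (x \<otimes> y) \<otimes> inv y = inv x' \<otimes> (x' \<otimes> y') \<otimes> inv y" by (simp add: eq)
      then show ?thesis using c by (simp add: m_assoc inv_mult_cancel)
    qed
    moreover have "inv x' \<otimes> x \<in> P" "y' \<otimes> inv y \<in> Q" using uv by auto
    ultimately have "inv x' \<otimes> x = \<one>" using PQ by auto
    then have "x = x'" using c by (metis inv_equality inv_inv inv_closed)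
    then have "y = y'" using eq c by simp
    with \<open>x = x'\<close> show "u = v" by (simp add: uv)
  qed
  have "?f ` (P \<times> Q) \<subseteq> carrier G" by auto
  moreover have "card (?f ` (P \<times> Q)) = card (carrier G)"
    using card_image[OF inj] card by (simp add: order_def card_cartesian_product)
  ultimately have "?f ` (P \<times> Q) = carrier G" using fin by (metis card_subset_eq)
  moreover have "?f \<in> hom (G\<lparr>carrier := P\<rparr> \<times>\<times> G\<lparr>carrier := Q\<rparr>) G"
  proof (rule homI)
    fix u v assume "u \<in> carrier (G\<lparr>carrier := P\<rparr> \<times>\<times> G\<lparr>carrier := Q\<rparr>)" "v \<in> carrier (G\<lparr>carrier := P\<rparr> \<times>\<times> G\<lparr>carrier := Q\<rparr>)"
    then obtain x y x' y' where uv: "u = (x, y)" "v = (x', y')" "x \<in> P" "y \<in> Q" "x' \<in> P" "y' \<in> Q" by auto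
    have "x \<otimes> x' \<otimes> (y \<otimes> y') = x \<otimes> (x' \<otimes> y) \<otimes> y'" using uv by (simp add: m_assoc)
    also have "\<dots> = x \<otimes> (y \<otimes> x') \<otimes> y'" by (simp only: comm[OF uv(5,4)])
    also have "\<dots> = x \<otimes> y \<otimes> (x' \<otimes> y')" using uv by (simp add: m_assoc)
    finally show "?f (u \<otimes>\<^bsub>G\<lparr>carrier := P\<rparr> \<times>\<times> G\<lparr>carrier := Q\<rparr>\<^esub> v) = ?f u \<otimes> ?f v" by (simp add: uv)
  qed auto
  ultimately have "?f \<in> iso (G\<lparr>carrier := P\<rparr> \<times>\<times> G\<lparr>carrier := Q\<rparr>) G"
    using inj by (intro isoI) (auto simp: bij_betw_def)
  then show ?thesis by (auto simp: is_iso_def)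
qed

end

text \<open>By the Chinese remainder theorem one exponent reaches any prescribed powers of both
  generators.\<close>

lemma cyclic_DirProd:
  assumes "group G" "group H" "finite (carrier G)" "finite (carrier H)"
    and "cyclic_group G" "cyclic_group H" and cop: "coprime (order G) (order H)"
  shows "cyclic_group (G \<times>\<times> H)"
proof -
  interpret G: group G by fact
  interpret H: group H by fact
  interpret GH: group "G \<times>\<times> H" by (rule DirProd_group) fact+
  obtain a where a: "a \<in> carrier G" "carrier G = range (\<lambda>i::int. a [^]\<^bsub>G\<^esub> i)"
    using assms(5) by (auto simp: G.cyclic_group)
  obtain b where b: "b \<in> carrier H" "carrier H = range (\<lambda>i::int. b [^]\<^bsub>H\<^esub> i)"
    using assms(6) by (auto simp: H.cyclic_group)
  have pow: "(a, b) [^]\<^bsub>G \<times>\<times> H\<^esub> k = (a [^]\<^bsub>G\<^esub> k, b [^]\<^bsub>H\<^esub> k)" for k :: int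
  proof -
    have nat: "(a, b) [^]\<^bsub>G \<times>\<times> H\<^esub> k = (a [^]\<^bsub>G\<^esub> k, b [^]\<^bsub>H\<^esub> k)" for k :: nat
      by (induction k) simp_all
    show ?thesis
    proof (cases k rule: int_cases2)
      case (nonneg n)
      then show ?thesis by (simp add: int_pow_int nat)
    next
      case (nonpos n)
      have "(a, b) [^]\<^bsub>G \<times>\<times> H\<^esub> k = inv\<^bsub>G \<times>\<times> H\<^esub> (a [^]\<^bsub>G\<^esub> n, b [^]\<^bsub>H\<^esub> n)"
        using a(1) b(1) GH.int_pow_neg[of "(a, b)" "int n"] by (simp add: nonpos int_pow_int nat)
      also have "\<dots> = (inv\<^bsub>G\<^esub> (a [^]\<^bsub>G\<^esub> n), inv\<^bsub>H\<^esub> (b [^]\<^bsub>H\<^esub> n))"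
        using a(1) b(1) by (intro inv_DirProd assms(1,2)) simp_all
      also have "\<dots> = (a [^]\<^bsub>G\<^esub> k, b [^]\<^bsub>H\<^esub> k)"
        using a(1) b(1) G.int_pow_neg[of a "int n"] H.int_pow_neg[of b "int n"] by (simp add: nonpos int_pow_int)
      finally show ?thesis .
    qed
  qed
  have "coprime (G.ord a) (H.ord b)"
    using cop a(1) b(1) by (meson G.ord_dvd_group_order H.ord_dvd_group_order coprime_divisors)
  then have cop': "coprime (int (G.ord a)) (int (H.ord b))" by simp
  have "(x, y) \<in> range (\<lambda>k::int. (a, b) [^]\<^bsub>G \<times>\<times> H\<^esub> k)" if xy: "x \<in> carrier G" "y \<in> carrier H" for x y
  proof -
    obtain i j :: int where ij: "x = a [^]\<^bsub>G\<^esub> i" "y = b [^]\<^bsub>H\<^esub> j" using xy a(2) b(2) by auto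
    obtain k where k: "[k = i] (mod int (G.ord a))" "[k = j] (mod int (H.ord b))"
      using binary_chinese_remainder_int[OF cop'] by blast
    then have "a [^]\<^bsub>G\<^esub> i = a [^]\<^bsub>G\<^esub> k" "b [^]\<^bsub>H\<^esub> j = b [^]\<^bsub>H\<^esub> k"
      using G.int_pow_eq[OF a(1)] H.int_pow_eq[OF b(1)] by (simp_all add: cong_iff_dvd_diff)
    then show ?thesis by (auto simp: ij pow)
  qed
  moreover have "range (\<lambda>k::int. (a, b) [^]\<^bsub>G \<times>\<times> H\<^esub> k) \<subseteq> carrier (G \<times>\<times> H)"
    using a(1) b(1) by (auto simp: pow)
  ultimately have range: "carrier (G \<times>\<times> H) = range (\<lambda>k::int. (a, b) [^]\<^bsub>G \<times>\<times> H\<^esub> k)" by auto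
  have "(a, b) \<in> carrier (G \<times>\<times> H)" using a(1) b(1) by simp
  then show ?thesis unfolding GH.cyclic_group using range by (intro bexI[of _ "(a, b)"])
qed

text \<open>A subgroup \<open>L\<close> of order \<open>q\<close> is the third vertex: since it
  differs in order from two subgroups of order \<open>p\<close>, those must coincide.\<close>

lemma (in group) sylow_cyclic_or_generalized_quaternion:
  assumes fin: "finite (carrier G)" and nil: "nilpotent_group G"
    and bip: "bipartite (intersection_subgroup_graph G)"
    and p: "Factorial_Ring.prime p" and q: "Factorial_Ring.prime q" and pq: "p \<noteq> q"
    and "q dvd order G" and order: "order G = p ^ k * m"
  obtains P where "subgroup P G" "card P = p ^ k"
    "cyclic_group (G\<lparr>carrier := P\<rparr>) \<or>
      (p = 2 \<and> (\<exists>a\<ge>3. G\<lparr>carrier := P\<rparr> \<cong> generalized_quaternion a))"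
proof -
  obtain P where P: "subgroup P G" "card P = p ^ k"
    using sylow_thm[OF p is_group order fin] by blast
  have "q dvd card (carrier G)" using assms(7) by (simp add: order_def)
  then obtain L where L: "subgroup L G" "card L = q"
    using exists_subgroup_card_prime[OF fin q subgroup_self] by blast
  interpret PG: p_group_unique_subgroup "G\<lparr>carrier := P\<rparr>" p k
  proof (intro p_group_unique_subgroup.intro p_group_unique_subgroup_axioms.intro)
    show "group (G\<lparr>carrier := P\<rparr>)" by (rule subgroup.subgroup_is_group[OF P(1) is_group])
    fix H K assume "subgroup H (G\<lparr>carrier := P\<rparr>)" "subgroup K (G\<lparr>carrier := P\<rparr>)"
      and card: "card H = p" "card K = p"
    then have "subgroup H G" "subgroup K G" using incl_subgroup[OF P(1)] by auto
    then have "H = K \<or> K = L \<or> H = L"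
      using bipartite_three_prime_subgroups[OF fin bip, of H K L] L card p q by simp
    then show "H = K" using card L(2) pq by auto
  qed (use p P nilpotent_subgroup[OF nil P(1)] in \<open>simp_all add: order_def\<close>)
  show thesis using that[OF P] PG.cyclic_or_generalized_quaternion by blast
qed

lemma (in group) bipartite_two_primes:
  assumes fin: "finite (carrier G)" and nil: "nilpotent_group G"
    and bip: "bipartite (intersection_subgroup_graph G)"
    and p: "Factorial_Ring.prime p" and q: "Factorial_Ring.prime q" and pq: "p \<noteq> q"
    and k: "k \<ge> 1" and s: "s \<ge> 1" and order: "order G = p ^ k * q ^ s"
  shows "G \<cong> integer_mod_group (p ^ k * q ^ s) \<or>
    (odd q \<and> (\<exists>a\<ge>3. G \<cong> generalized_quaternion a \<times>\<times> integer_mod_group (q ^ s))) \<or>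
    (odd p \<and> (\<exists>a\<ge>3. G \<cong> generalized_quaternion a \<times>\<times> integer_mod_group (p ^ k)))"
proof -
  obtain P where P: "subgroup P G" "card P = p ^ k"
    and P_cases: "cyclic_group (G\<lparr>carrier := P\<rparr>) \<or>
      (p = 2 \<and> (\<exists>a\<ge>3. G\<lparr>carrier := P\<rparr> \<cong> generalized_quaternion a))"
    using sylow_cyclic_or_generalized_quaternion[OF fin nil bip p q pq _ order] order s by auto
  have order': "order G = q ^ s * p ^ k" using order by simp
  obtain Q where Q: "subgroup Q G" "card Q = q ^ s"
    and Q_cases: "cyclic_group (G\<lparr>carrier := Q\<rparr>) \<or>
      (q = 2 \<and> (\<exists>a\<ge>3. G\<lparr>carrier := Q\<rparr> \<cong> generalized_quaternion a))"
    using sylow_cyclic_or_generalized_quaternion[OF fin nil bip q p pq[symmetric] _ order'] order k by auto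
  let ?P = "G\<lparr>carrier := P\<rparr>" and ?Q = "G\<lparr>carrier := Q\<rparr>"
  interpret PG: group ?P by (rule subgroup.subgroup_is_group[OF P(1) is_group])
  interpret QG: group ?Q by (rule subgroup.subgroup_is_group[OF Q(1) is_group])
  have cop: "coprime (p ^ k) (q ^ s)" using primes_coprime[OF p q pq] by simp
  have orders: "order ?P = p ^ k" "order ?Q = q ^ s" using P Q by (simp_all add: order_def)
  have fins: "finite (carrier ?P)" "finite (carrier ?Q)"
    using P Q subgroup.subset fin by (auto intro: finite_subset)
  have pow_P: "x [^] (p ^ k) = \<one>" if "x \<in> P" for x
    using PG.pow_order_eq_1[of x] that orders(1) nat_pow_consistent[of x "p ^ k" P] by simp
  have pow_Q: "x [^] (q ^ s) = \<one>" if "x \<in> Q" for x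
    using QG.pow_order_eq_1[of x] that orders(2) nat_pow_consistent[of x "q ^ s" Q] by simp
  have in_carrier: "P \<subseteq> carrier G" "Q \<subseteq> carrier G" using P Q subgroup.subset by auto
  have "P \<inter> Q \<subseteq> {\<one>}"
  proof
    fix x assume x: "x \<in> P \<inter> Q"
    then have xc: "x \<in> carrier G" using in_carrier by auto
    have "ord x dvd p ^ k" "ord x dvd q ^ s" using x pow_P pow_Q pow_eq_id[OF xc] by auto
    then have "ord x = 1" using cop by (metis coprime_common_divisor_nat)
    then show "x \<in> {\<one>}" using ord_eq_1[OF xc] by simp
  qed
  then have PQ: "P \<inter> Q = {\<one>}" using P(1) Q(1) subgroup.one_closed by blast
  have "x \<otimes> y = y \<otimes> x" if "x \<in> P" "y \<in> Q" for x y
    using nilpotent_coprime_commute[OF nil _ _ pow_P[OF that(1)] pow_Q[OF that(2)] cop] that in_carrier by auto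
  moreover have "order G = card P * card Q" by (simp only: order P(2) Q(2))
  ultimately have prod: "?P \<times>\<times> ?Q \<cong> G"
    by (intro iso_DirProd_subgroups[OF fin P(1) Q(1) _ PQ])
  then have G_PQ: "G \<cong> ?P \<times>\<times> ?Q" by (rule group.iso_sym[OF DirProd_group[OF PG.is_group QG.is_group]])
  have odd: "odd r" if "Factorial_Ring.prime r" "r \<noteq> 2" for r :: nat
    using that primes_dvd_imp_eq two_is_prime_nat by blast
  have P_iso: "?P \<cong> integer_mod_group (p ^ k)" if "cyclic_group ?P"
    using PG.cyclic_iso_integer_mod_group[OF fins(1) that] orders by simp
  have Q_iso: "?Q \<cong> integer_mod_group (q ^ s)" if "cyclic_group ?Q"
    using QG.cyclic_iso_integer_mod_group[OF fins(2) that] orders by simp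
  \<comment> \<open>Both factors cannot be generalized quaternion, as this would force
    \<open>p = q = 2\<close>.\<close>
  consider (cyclic) "cyclic_group ?P" "cyclic_group ?Q"
    | (P) a where "p = 2" "a \<ge> 3" "?P \<cong> generalized_quaternion a" "cyclic_group ?Q"
    | (Q) a where "q = 2" "a \<ge> 3" "?Q \<cong> generalized_quaternion a" "cyclic_group ?P"
    using P_cases Q_cases pq by blast
  then show ?thesis
  proof cases
    case cyclic
    then have "cyclic_group (?P \<times>\<times> ?Q)"
      using cyclic_DirProd[OF PG.is_group QG.is_group fins] cop orders by simp
    then have "cyclic_group G"
      using isomorphic_group_cyclicity[OF prod DirProd_group[OF PG.is_group QG.is_group] is_group] by simp
    then show ?thesis using cyclic_iso_integer_mod_group[OF fin] order by simp
  next
    case P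
    have "G \<cong> generalized_quaternion a \<times>\<times> integer_mod_group (q ^ s)"
      using iso_trans[OF G_PQ PG.DirProd_iso_trans[OF P(3) Q_iso[OF P(4)]]] .
    then show ?thesis using P(1,2) pq odd[OF q] by blast
  next
    case Q
    have "G \<cong> ?Q \<times>\<times> ?P" using iso_trans[OF G_PQ DirProd_commute_iso] .
    then have "G \<cong> generalized_quaternion a \<times>\<times> integer_mod_group (p ^ k)"
      using iso_trans[OF _ QG.DirProd_iso_trans[OF Q(3) P_iso[OF Q(4)]]] by blast
    then show ?thesis using Q(1,2) pq odd[OF p] by blast
  qed
qed

theorem corollary3p1:
  fixes G (structure)
  assumes "group G" and "finite (carrier G)" and "nilpotent_group G"
  shows "bipartite (intersection_subgroup_graph G) \<longleftrightarrow>
      (cyclic_group G \<and> (\<exists>(p::nat) k. Factorial_Ring.prime p \<and> order G = p ^ k)) \<or>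
      (\<exists>n\<ge>3. G \<cong> generalized_quaternion n) \<or>
      (\<exists>a b (q::nat). a \<ge> 3 \<and> b \<ge> 1 \<and> Factorial_Ring.prime q \<and> odd q \<and>
         G \<cong> generalized_quaternion a \<times>\<times> integer_mod_group (q ^ b)) \<or>
      (\<exists>(p::nat) (q::nat) k s. Factorial_Ring.prime p \<and> Factorial_Ring.prime q \<and> p \<noteq> q \<and> k \<ge> 1 \<and> s \<ge> 1 \<and>
         G \<cong> integer_mod_group (p ^ k * q ^ s))"
    (is "?B \<longleftrightarrow> ?cyclic \<or> ?quaternion \<or> ?product \<or> ?two")
proof
  interpret group G by fact
  note fin = assms(2) and nil = assms(3)
  assume bip: ?B
  have order_pos: "order G > 0" using fin by (simp add: order_gt_0_iff_finite)
  show "?cyclic \<or> ?quaternion \<or> ?product \<or> ?two"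
  proof (cases "order G = 1")
    case True
    then have "trivial_group G" by (auto simp: trivial_group order_def card_1_singleton_iff)
    \<comment> \<open>The trivial group falls under the cyclic \<open>p\<close>-groups with exponent
      0.\<close>
    moreover have "order G = 2 ^ 0" using True by simp
    ultimately show ?thesis using trivial_imp_cyclic_group two_is_prime_nat by blast
  next
    case False
    then obtain p where p: "Factorial_Ring.prime p" "p dvd order G" using prime_factor_nat by blast
    define k where "k = multiplicity p (order G)"
    obtain m where m: "order G = p ^ k * m" "\<not> p dvd m"
      unfolding k_def by (rule multiplicity_decompose'[of "order G" p]) (use order_pos p in auto)
    have k: "k \<ge> 1" using m p(2) by (cases k) auto
    show ?thesis
    proof (cases "m = 1")
      case True
      then have order: "order G = p ^ k" using m by simp
      interpret p_group_unique_subgroup G p k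
        by (rule bipartite_p_group_unique_subgroup[OF nil bip p(1) order k])
      show ?thesis using cyclic_or_generalized_quaternion order p(1) by blast
    next
      case False
      then obtain q where q: "Factorial_Ring.prime q" "q dvd m" using prime_factor_nat by blast
      have pq: "p \<noteq> q" using q m(2) by auto
      define s where "s = multiplicity q m"
      have "m > 0" using order_pos m by (cases m) auto
      obtain t where t: "m = q ^ s * t" "\<not> q dvd t"
        unfolding s_def by (rule multiplicity_decompose'[of m q]) (use q \<open>m > 0\<close> in auto)
      have s: "s \<ge> 1" using t q(2) by (cases s) auto
      \<comment> \<open>A third prime divisor would give subgroups of three different prime orders,
        hence a triangle.\<close>
      have "t = 1"
      proof (rule ccontr)
        assume "t \<noteq> 1"
        then obtain r where r: "Factorial_Ring.prime r" "r dvd t" using prime_factor_nat by blast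
        have dvds: "r dvd card (carrier G)" "q dvd card (carrier G)" "p dvd card (carrier G)"
          using r q p t m by (simp_all add: order_def[symmetric])
        obtain H where H: "subgroup H G" "card H = p"
          using exists_subgroup_card_prime[OF fin p(1) subgroup_self dvds(3)] by blast
        obtain K where K: "subgroup K G" "card K = q"
          using exists_subgroup_card_prime[OF fin q(1) subgroup_self dvds(2)] by blast
        obtain L where L: "subgroup L G" "card L = r"
          using exists_subgroup_card_prime[OF fin r(1) subgroup_self dvds(1)] by blast
        have "p \<noteq> r" "q \<noteq> r" using r t m by auto
        moreover have "H = K \<or> K = L \<or> H = L"
          using bipartite_three_prime_subgroups[OF fin bip H(1) _ K(1) _ L(1)] H(2) K(2) L(2) p q r by simp
        ultimately show False using pq H K L by auto
      qed
      then have "order G = p ^ k * q ^ s" using m t by simp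
      from bipartite_two_primes[OF fin nil bip p(1) q(1) pq k s this]
      show ?thesis using p(1) q(1) pq k s by blast
    qed
  qed
next
  interpret group G by fact
  note fin = assms(2)
  assume "?cyclic \<or> ?quaternion \<or> ?product \<or> ?two"
  then consider ?cyclic | ?quaternion | ?product | ?two by blast
  then show ?B
  proof cases
    case 1
    then obtain p k where "cyclic_group G" "Factorial_Ring.prime p" "order G = p ^ k" by blast
    then show ?thesis
      by (intro bipartite_cyclic[OF fin, of p p]) (auto dest: prime_dvd_prime_power_imp_eq)
  next
    case 2
    then obtain n where n: "n \<ge> 3" "G \<cong> generalized_quaternion n" by blast
    show ?thesis
      by (rule bipartite_iso[OF group_generalized_quaternion[OF n(1)] n(2)
            power_covered_generalized_quaternion[OF n(1)]]) simp_all
  next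
    case 3
    then obtain a b q where abq: "a \<ge> 3" "b \<ge> 1" "Factorial_Ring.prime q" "odd q"
      and iso: "G \<cong> generalized_quaternion a \<times>\<times> integer_mod_group (q ^ b)" by blast
    let ?Q = "generalized_quaternion a" and ?Z = "integer_mod_group (q ^ b)"
    have Q: "group ?Q" by (rule group_generalized_quaternion[OF abq(1)])
    interpret Z: group ?Z by simp
    have q_pos: "q > 0" using abq(3) by (simp add: prime_gt_0_nat)
    have order_Z: "order ?Z = q ^ b" using q_pos by (simp add: order_integer_mod_group)
    have fin_Z: "finite (carrier ?Z)" using q_pos by (simp add: carrier_integer_mod_group)
    have fin_Q: "finite (carrier ?Q)" by (simp add: generalized_quaternion_def)
    \<comment> \<open>As \<open>q\<close> is the only prime divisor, \<open>N\<close> has at most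
      one element; together with the involution of \<open>?Q\<close> this stays within the bound
      2.\<close>
    obtain N where N: "power_covered ?Z N" "finite N" "card N \<le> card {q}"
      by (rule Z.cyclic_power_covered[OF fin_Z cyclic_integer_mod_group, of "{q}"])
        (use abq in \<open>auto simp: order_Z dest: prime_dvd_prime_power_imp_eq\<close>)
    have "coprime (order ?Q) (order ?Z)"
      using abq(4) by (simp add: order_Z order_generalized_quaternion[OF abq(1)])
    from power_covered_DirProd[OF Q Z.is_group fin_Q fin_Z this
        power_covered_generalized_quaternion[OF abq(1)] N(1)]
    show ?thesis
    proof (rule bipartite_iso[OF DirProd_group[OF Q Z.is_group] iso])
      show "card ({(2 ^ (a - 2), False)} \<times> {\<one>\<^bsub>?Z\<^esub>} \<union> {\<one>\<^bsub>?Q\<^esub>} \<times> N) \<le> 2"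
        using N(3) by (intro order_trans[OF card_Un_le]) (simp add: card_cartesian_product)
    qed (use N(2) in simp)
  next
    case 4
    then obtain p q k s where pq: "Factorial_Ring.prime p" "Factorial_Ring.prime q"
      and iso: "G \<cong> integer_mod_group (p ^ k * q ^ s)" by blast
    have "cyclic_group G"
      using isomorphic_group_cyclicity[OF iso is_group] cyclic_integer_mod_group by simp
    moreover have "order G = p ^ k * q ^ s"
      using iso_same_card[OF iso] pq order_integer_mod_group[of "p ^ k * q ^ s"]
      by (simp add: order_def prime_gt_0_nat)
    ultimately show ?thesis
      using pq by (intro bipartite_cyclic[OF fin, of p q])
        (auto simp: prime_dvd_mult_iff dest: prime_dvd_prime_power_imp_eq)
  qed
qed

end
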